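(* Up to inner automorphism, the Levi decomposable subalgebras of $A_2$ are classified by the following list: every Levi decomposable subalgebra of $A_2$ is equivalent up to inner automorphism to exactly one of the five subalgebras below (in particular the five are pairwise inequivalent), and each has the isomorphism type indicated: $$\begin{array}{lll} \langle x_3, y_3, h_1+h_2\rangle \oplus \langle h_1-h_2\rangle &\cong& A_1 \oplus J,\\ \langle x_3, y_3, h_1+h_2\rangle \ltimes \langle x_1, y_2 \rangle &\cong& A_1 \ltimes_{\varphi_1} K_1,\\ \langle x_3, y_3, h_1+h_2\rangle \ltimes \langle x_2, y_1\rangle &\cong& A_1 \ltimes_{\varphi_1} K_1,\\ \langle x_3, y_3, h_1+h_2\rangle \ltimes \langle h_1-h_2, x_1, y_2 \rangle &\cong& A_1 \ltimes_{\varphi_2} L_2,\\ \langle x_3, y_3, h_1+h_2\rangle \ltimes \langle h_1-h_2, x_2, y_1\rangle &\cong& A_1 \ltimes_{\varphi_2} L_2. \end{array}$$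
   Context: All Lie algebras are finite-dimensional over $\mathbb{C}$. $A_n$ denotes the Lie algebra of traceless $(n+1)\times(n+1)$ complex matrices ($n=1,2$). The Chevalley basis $x_i,y_i$ ($1\le i\le 3$), $h_1,h_2$ of $A_2$ is defined by $$ah_1+bh_2+cx_1+dx_2+ex_3+c'y_1+d'y_2+e'y_3=\begin{pmatrix} a & c & -e\\ c' & b-a & d\\ -e' & d' & -b\end{pmatrix}.$$ $\langle W_1,\dots,W_m\rangle$ denotes the Lie subalgebra of $A_2$ generated by $W_1,\dots,W_m$. Two subalgebras of $A_2$ are equivalent up to inner automorphism if an inner automorphism of $A_2$ maps one onto the other, i.e. if they are conjugate by an element of $\mathrm{SL}(3,\mathbb{C})$. A Lie algebra is Levi decomposable if it is a semidirect or direct sum of a nonzero semisimple subalgebra and a nonzero solvable subalgebra (the latter being an ideal). Written $\mathfrak{g}\ltimes\mathfrak{s}$, the semidirect sum has $\mathfrak{s}$ as ideal; for a Lie algebra homomorphism $\varphi:\mathfrak{g}\to \mathrm{Der}(\mathfrak{s})$, $\mathfrak{g}\ltimes_\varphi\mathfrak{s}$ is the semidirect sum with $[x,y]=\varphi(x)(y)$ for $x\in\mathfrak{g}$, $y\in\mathfrak{s}$. $J$ is the 1-dimensional abelian Lie algebra; $K_1$ is the 2-dimensional abelian Lie algebra with basis $z_1,z_2$; $L_2$ is the 3-dimensional Lie algebra with basis $z_1,z_2,z_3$ and nonzero brackets $[z_3,z_1]=z_1$, $[z_3,z_2]=z_2$. Let $\{x,y,h\}$ be a Chevalley basis of $A_1$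 ($[x,y]=h$, $[h,x]=2x$, $[h,y]=-2y$) and let $\chi:A_1\hookrightarrow A_2$ be the embedding $x\mapsto x_3$, $y\mapsto y_3$, $h\mapsto h_1+h_2$. Let $\psi_1:K_1\to A_2$ be the injective homomorphism $z_1\mapsto x_1$, $z_2\mapsto y_2$, and $\psi_2:L_2\to A_2$ the injective homomorphism $z_1\mapsto x_1$, $z_2\mapsto y_2$, $z_3\mapsto \tfrac13(h_1-h_2)$. The homomorphisms $\varphi_1:A_1\to\mathrm{Der}(K_1)$ and $\varphi_2:A_1\to\mathrm{Der}(L_2)$ are defined by $\varphi_j(T)(z_i)=\psi_j^{-1}([\chi(T),\psi_j(z_i)])$ for $T\in A_1$ and all basis elements $z_i$ ($i=1,2$ for $j=1$; $i=1,2,3$ for $j=2$). *)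

theory Defs
  imports "HOL-Analysis.Analysis"
begin

section \<open>Complex Lie algebras\<close>

text \<open>
  The additive structure is that of the ambient type; the complex scalar multiplication is a field
  of the record, since the complex matrices carry no suitable type class instance. A subalgebra
  \<open>K\<close> of \<open>G\<close>, regarded as a Lie algebra in its own right, is \<open>G\<lparr>lie_carrier := K\<rparr>\<close>.
\<close>

record 'a lie =
  lie_carrier :: "'a set"
  lie_scale :: "complex \<Rightarrow> 'a \<Rightarrow> 'a"
  lie_bracket :: "'a \<Rightarrow> 'a \<Rightarrow> 'a"

definition lie_algebra :: "'a::ab_group_add lie \<Rightarrow> bool" where
  "lie_algebra G \<longleftrightarrow>
     vector_space (lie_scale G) \<and>
     module.subspace (lie_scale G) (lie_carrier G) \<and>
     (\<forall>a\<in>lie_carrier G. \<forall>b\<in>lie_carrier G. lie_bracket G a b \<in> lie_carrier G) \<and>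
     (\<forall>a\<in>lie_carrier G. \<forall>b\<in>lie_carrier G. \<forall>c\<in>lie_carrier G.
        lie_bracket G (a + b) c = lie_bracket G a c + lie_bracket G b c \<and>
        lie_bracket G a (b + c) = lie_bracket G a b + lie_bracket G a c) \<and>
     (\<forall>k. \<forall>a\<in>lie_carrier G. \<forall>b\<in>lie_carrier G.
        lie_bracket G (lie_scale G k a) b = lie_scale G k (lie_bracket G a b) \<and>
        lie_bracket G a (lie_scale G k b) = lie_scale G k (lie_bracket G a b)) \<and>
     (\<forall>a\<in>lie_carrier G. lie_bracket G a a = 0) \<and>
     (\<forall>a\<in>lie_carrier G. \<forall>b\<in>lie_carrier G. \<forall>c\<in>lie_carrier G.
        lie_bracket G a (lie_bracket G b c) + lie_bracket G b (lie_bracket G c a)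
          + lie_bracket G c (lie_bracket G a b) = 0)"

definition lie_subalgebra :: "'a::ab_group_add set \<Rightarrow> 'a lie \<Rightarrow> bool" where
  "lie_subalgebra K G \<longleftrightarrow>
     K \<subseteq> lie_carrier G \<and> module.subspace (lie_scale G) K \<and>
     (\<forall>a\<in>K. \<forall>b\<in>K. lie_bracket G a b \<in> K)"

definition lie_ideal :: "'a::ab_group_add set \<Rightarrow> 'a lie \<Rightarrow> bool" where
  "lie_ideal I G \<longleftrightarrow>
     I \<subseteq> lie_carrier G \<and> module.subspace (lie_scale G) I \<and>
     (\<forall>a\<in>lie_carrier G. \<forall>b\<in>I. lie_bracket G a b \<in> I)"

definition lie_generated :: "'a::ab_group_add lie \<Rightarrow> 'a set \<Rightarrow> 'a set" where
  "lie_generated G S = (\<lambda>K. lie_subalgebra K G) hull S"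

definition lie_hom :: "('a::ab_group_add \<Rightarrow> 'b::ab_group_add) \<Rightarrow> 'a lie \<Rightarrow> 'b lie \<Rightarrow> bool" where
  "lie_hom f G H \<longleftrightarrow>
     f ` lie_carrier G \<subseteq> lie_carrier H \<and>
     (\<forall>a\<in>lie_carrier G. \<forall>b\<in>lie_carrier G. f (a + b) = f a + f b) \<and>
     (\<forall>k. \<forall>a\<in>lie_carrier G. f (lie_scale G k a) = lie_scale H k (f a)) \<and>
     (\<forall>a\<in>lie_carrier G. \<forall>b\<in>lie_carrier G.
        f (lie_bracket G a b) = lie_bracket H (f a) (f b))"

definition lie_isomorphic :: "'a::ab_group_add lie \<Rightarrow> 'b::ab_group_add lie \<Rightarrow> bool" where
  "lie_isomorphic G H \<longleftrightarrow>
     (\<exists>f. lie_hom f G H \<and> bij_betw f (lie_carrier G) (lie_carrier H))"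

primrec derived_series :: "'a::ab_group_add lie \<Rightarrow> nat \<Rightarrow> 'a set" where
  "derived_series G 0 = lie_carrier G"
| "derived_series G (Suc n) =
     module.span (lie_scale G)
       {lie_bracket G a b | a b. a \<in> derived_series G n \<and> b \<in> derived_series G n}"

definition lie_solvable :: "'a::ab_group_add lie \<Rightarrow> bool" where
  "lie_solvable G \<longleftrightarrow> (\<exists>n. derived_series G n = {0})"

text \<open>Equivalently, the radical vanishes. With this convention the zero algebra is semisimple.\<close>

definition lie_semisimple :: "'a::ab_group_add lie \<Rightarrow> bool" where
  "lie_semisimple G \<longleftrightarrow>
     (\<forall>I. lie_ideal I G \<and> lie_solvable (G\<lparr>lie_carrier := I\<rparr>) \<longrightarrow> I = {0})"

definition subspace_sum :: "'a::ab_group_add set \<Rightarrow> 'a set \<Rightarrow> 'a set" where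
  "subspace_sum U V = {u + v | u v. u \<in> U \<and> v \<in> V}"

text \<open>Internal semidirect sum (ideal in the last argument) and internal direct sum.\<close>

definition is_semidirect_sum :: "'a::ab_group_add lie \<Rightarrow> 'a set \<Rightarrow> 'a set \<Rightarrow> bool" where
  "is_semidirect_sum G U V \<longleftrightarrow>
     lie_subalgebra U G \<and> lie_ideal V G \<and> U \<inter> V = {0} \<and> lie_carrier G = subspace_sum U V"

definition is_direct_sum :: "'a::ab_group_add lie \<Rightarrow> 'a set \<Rightarrow> 'a set \<Rightarrow> bool" where
  "is_direct_sum G U V \<longleftrightarrow>
     lie_ideal U G \<and> lie_ideal V G \<and> U \<inter> V = {0} \<and> lie_carrier G = subspace_sum U V"

definition levi_decomposable :: "'a::ab_group_add lie \<Rightarrow> bool" where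
  "levi_decomposable G \<longleftrightarrow>
     (\<exists>U V. (is_semidirect_sum G U V \<or> is_direct_sum G U V) \<and>
        U \<noteq> {0} \<and> lie_semisimple (G\<lparr>lie_carrier := U\<rparr>) \<and>
        V \<noteq> {0} \<and> lie_solvable (G\<lparr>lie_carrier := V\<rparr>))"

text \<open>External sums. In the semidirect sum, \<open>\<phi>\<close> is meant to be an action by derivations.\<close>

definition lie_direct_sum ::
    "'a::ab_group_add lie \<Rightarrow> 'b::ab_group_add lie \<Rightarrow> ('a \<times> 'b) lie" where
  "lie_direct_sum G H =
     \<lparr>lie_carrier = lie_carrier G \<times> lie_carrier H,
      lie_scale = (\<lambda>k (a, u). (lie_scale G k a, lie_scale H k u)),
      lie_bracket = (\<lambda>(a, u) (b, v). (lie_bracket G a b, lie_bracket H u v))\<rparr>"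

definition lie_semidirect_sum ::
    "'a::ab_group_add lie \<Rightarrow> ('a \<Rightarrow> 'b \<Rightarrow> 'b) \<Rightarrow> 'b::ab_group_add lie \<Rightarrow> ('a \<times> 'b) lie" where
  "lie_semidirect_sum G \<phi> H =
     \<lparr>lie_carrier = lie_carrier G \<times> lie_carrier H,
      lie_scale = (\<lambda>k (a, u). (lie_scale G k a, lie_scale H k u)),
      lie_bracket = (\<lambda>(a, u) (b, v).
        (lie_bracket G a b, \<phi> a v - \<phi> b u + lie_bracket H u v))\<rparr>"


section \<open>The algebras $A_n$, $J$, $K_1$, $L_2$\<close>

definition mscale :: "complex \<Rightarrow> complex^'n^'n \<Rightarrow> complex^'n^'n" where
  "mscale k = map_matrix ((*) k)"

definition sl_lie :: "(complex^'n^'n) lie" where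
  "sl_lie = \<lparr>lie_carrier = {A. trace A = 0}, lie_scale = mscale,
             lie_bracket = (\<lambda>A B. A ** B - B ** A)\<rparr>"

abbreviation A\<^sub>1 :: "(complex^2^2) lie" where "A\<^sub>1 \<equiv> sl_lie"
abbreviation A\<^sub>2 :: "(complex^3^3) lie" where "A\<^sub>2 \<equiv> sl_lie"

definition J :: "complex lie" where
  "J = \<lparr>lie_carrier = UNIV, lie_scale = (*), lie_bracket = (\<lambda>_ _. 0)\<rparr>"

text \<open>In \<open>K\<^sub>1\<close> and \<open>L\<^sub>2\<close> the basis element $z_i$ is \<open>axis i 1\<close>.\<close>

definition K\<^sub>1 :: "(complex^2) lie" where
  "K\<^sub>1 = \<lparr>lie_carrier = UNIV, lie_scale = (*s), lie_bracket = (\<lambda>_ _. 0)\<rparr>"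

definition L\<^sub>2 :: "(complex^3) lie" where
  "L\<^sub>2 = \<lparr>lie_carrier = UNIV, lie_scale = (*s),
         lie_bracket = (\<lambda>u v. vector [u$3 * v$1 - v$3 * u$1, u$3 * v$2 - v$3 * u$2, 0])\<rparr>"

lemma vector_space_mscale: "vector_space (mscale :: complex \<Rightarrow> complex^'n^'n \<Rightarrow> _)"
  by unfold_locales (simp_all add: mscale_def vec_eq_iff algebra_simps)

lemma lie_algebra_sl: "lie_algebra (sl_lie :: (complex^'n^'n) lie)"
proof -
  interpret vector_space "mscale :: complex \<Rightarrow> complex^'n^'n \<Rightarrow> _"
    by (rule vector_space_mscale)
  have scale_mult: "mscale k A ** B = mscale k (A ** B)" "A ** mscale k B = mscale k (A ** B)"
    for k and A B :: "complex^'n^'n"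
    by (simp_all add: mscale_def vec_eq_iff matrix_matrix_mult_def sum_distrib_left algebra_simps)
  have distrib: "(A + B) ** C = A ** C + B ** C"
      "(A - B) ** C = A ** C - B ** C" "A ** (B - C) = A ** B - A ** C"
    for A B C :: "complex^'n^'n"
    by (simp_all add: vec_eq_iff matrix_matrix_mult_def sum.distrib sum_subtractf algebra_simps)
  have "subspace {A :: complex^'n^'n. trace A = 0}"
    by (rule subspaceI)
       (auto simp: mscale_def trace_def sum.distrib simp flip: sum_distrib_left)
  moreover have "trace (A ** B - B ** A) = 0" for A B :: "complex^'n^'n"
    by (simp add: trace_sub trace_mul_sym[of A B])
  ultimately show ?thesis
    unfolding lie_algebra_def
    by (auto simp: sl_lie_def vector_space_mscale scale_mult
        scale_right_diff_distrib matrix_add_ldistrib distrib matrix_mul_assoc)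
qed

lemma lie_algebra_J: "lie_algebra J"
  using vector_space_over_itself.vector_space_axioms vector_space_over_itself.subspace_UNIV
  by (simp add: lie_algebra_def J_def)

lemma lie_algebra_K\<^sub>1: "lie_algebra K\<^sub>1"
  using vec.vector_space_axioms by (simp add: lie_algebra_def K\<^sub>1_def)

lemma lie_algebra_L\<^sub>2: "lie_algebra L\<^sub>2"
  using vec.vector_space_axioms
  by (simp add: lie_algebra_def L\<^sub>2_def vec_eq_iff forall_3 algebra_simps)

lemma lie_bracket_L\<^sub>2:
  "lie_bracket L\<^sub>2 (axis 3 1) (axis 1 1) = axis 1 1"
  "lie_bracket L\<^sub>2 (axis 3 1) (axis 2 1) = axis 2 1"
  "lie_bracket L\<^sub>2 (axis 1 1) (axis 2 1) = 0"
  by (simp_all add: L\<^sub>2_def vec_eq_iff forall_3 axis_def)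


section \<open>The Chevalley basis of $A_2$ and conjugacy\<close>

definition chevalley_matrix ::
    "complex \<Rightarrow> complex \<Rightarrow> complex \<Rightarrow> complex \<Rightarrow> complex \<Rightarrow> complex \<Rightarrow> complex \<Rightarrow> complex \<Rightarrow> complex^3^3" where
  "chevalley_matrix a b c d e c' d' e' =
     vector [vector [a, c, - e], vector [c', b - a, d], vector [- e', d', - b]]"

definition h\<^sub>1 :: "complex^3^3" where "h\<^sub>1 = chevalley_matrix 1 0 0 0 0 0 0 0"
definition h\<^sub>2 :: "complex^3^3" where "h\<^sub>2 = chevalley_matrix 0 1 0 0 0 0 0 0"
definition x\<^sub>1 :: "complex^3^3" where "x\<^sub>1 = chevalley_matrix 0 0 1 0 0 0 0 0"
definition x\<^sub>2 :: "complex^3^3" where "x\<^sub>2 = chevalley_matrix 0 0 0 1 0 0 0 0"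
definition x\<^sub>3 :: "complex^3^3" where "x\<^sub>3 = chevalley_matrix 0 0 0 0 1 0 0 0"
definition y\<^sub>1 :: "complex^3^3" where "y\<^sub>1 = chevalley_matrix 0 0 0 0 0 1 0 0"
definition y\<^sub>2 :: "complex^3^3" where "y\<^sub>2 = chevalley_matrix 0 0 0 0 0 0 1 0"
definition y\<^sub>3 :: "complex^3^3" where "y\<^sub>3 = chevalley_matrix 0 0 0 0 0 0 0 1"

definition inner_automorphism :: "(complex^3^3 \<Rightarrow> complex^3^3) \<Rightarrow> bool" where
  "inner_automorphism f \<longleftrightarrow>
     (\<exists>P :: complex^3^3. det P = 1 \<and> f = (\<lambda>A. P ** A ** matrix_inv P))"

definition inner_equivalent :: "(complex^3^3) set \<Rightarrow> (complex^3^3) set \<Rightarrow> bool" where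
  "inner_equivalent M N \<longleftrightarrow> (\<exists>f. inner_automorphism f \<and> f ` M = N)"


section \<open>The homomorphisms $\chi$, $\psi_j$, $\varphi_j$\<close>

definition A1_chevalley_basis :: "complex^2^2 \<Rightarrow> complex^2^2 \<Rightarrow> complex^2^2 \<Rightarrow> bool" where
  "A1_chevalley_basis x y h \<longleftrightarrow>
     distinct [x, y, h] \<and>
     \<not> module.dependent (lie_scale A\<^sub>1) {x, y, h} \<and>
     module.span (lie_scale A\<^sub>1) {x, y, h} = lie_carrier A\<^sub>1 \<and>
     lie_bracket A\<^sub>1 x y = h \<and>
     lie_bracket A\<^sub>1 h x = mscale 2 x \<and>
     lie_bracket A\<^sub>1 h y = mscale (- 2) y"

definition is_chi ::
    "complex^2^2 \<Rightarrow> complex^2^2 \<Rightarrow> complex^2^2 \<Rightarrow> (complex^2^2 \<Rightarrow> complex^3^3) \<Rightarrow> bool" where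
  "is_chi x y h ch \<longleftrightarrow>
     lie_hom ch A\<^sub>1 A\<^sub>2 \<and> inj_on ch (lie_carrier A\<^sub>1) \<and>
     ch x = x\<^sub>3 \<and> ch y = y\<^sub>3 \<and> ch h = h\<^sub>1 + h\<^sub>2"

definition \<psi>\<^sub>1 :: "complex^2 \<Rightarrow> complex^3^3" where
  "\<psi>\<^sub>1 z = mscale (z$1) x\<^sub>1 + mscale (z$2) y\<^sub>2"

definition \<psi>\<^sub>2 :: "complex^3 \<Rightarrow> complex^3^3" where
  "\<psi>\<^sub>2 z = mscale (z$1) x\<^sub>1 + mscale (z$2) y\<^sub>2 + mscale (z$3) (mscale (1/3) (h\<^sub>1 - h\<^sub>2))"

text \<open>
  The linear map given on the basis by $z_i \mapsto \psi^{-1}([\chi(T), \psi(z_i)])$.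
\<close>

definition induced_action ::
    "(complex^2^2 \<Rightarrow> complex^3^3) \<Rightarrow> (complex^'n \<Rightarrow> complex^3^3) \<Rightarrow>
     complex^2^2 \<Rightarrow> complex^'n \<Rightarrow> complex^'n" where
  "induced_action ch \<psi> T z =
     (\<Sum>i\<in>UNIV. (z$i) *s inv \<psi> (lie_bracket A\<^sub>2 (ch T) (\<psi> (axis i 1))))"

definition \<phi>\<^sub>1 :: "(complex^2^2 \<Rightarrow> complex^3^3) \<Rightarrow> complex^2^2 \<Rightarrow> complex^2 \<Rightarrow> complex^2" where
  "\<phi>\<^sub>1 ch = induced_action ch \<psi>\<^sub>1"

definition \<phi>\<^sub>2 :: "(complex^2^2 \<Rightarrow> complex^3^3) \<Rightarrow> complex^2^2 \<Rightarrow> complex^3 \<Rightarrow> complex^3" where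
  "\<phi>\<^sub>2 ch = induced_action ch \<psi>\<^sub>2"

end

theory Submission
  imports Defs "HOL-Computational_Algebra.Fundamental_Theorem_Algebra"
begin

text \<open>
  Let \<open>N = U + V\<close> be Levi decomposable. The last nonzero term \<open>W\<close> of the derived series of \<open>V\<close> is an
  abelian ideal of \<open>N\<close>. For \<open>A\<close> in \<open>W\<close> and \<open>X\<close> in \<open>N\<close> the commutator \<open>[A, X]\<close> commutes with \<open>A\<close>, so it is
  nilpotent; therefore \<open>N\<close> stabilises the weight spaces of \<open>W\<close>, and so a line or a plane. The outer
  automorphism \<open>A \<mapsto> - A\<^sup>T\<close> exchanges the two cases. If the plane is spanned by \<open>e\<^sub>1\<close> and \<open>e\<^sub>3\<close>, then
  \<open>U\<close> projects isomorphically onto the \<open>sl\<^sub>2\<close> of that plane, because every proper subalgebra of \<open>sl\<^sub>2\<close> is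
  solvable, and a unipotent matrix conjugates \<open>U\<close> to this \<open>sl\<^sub>2\<close>. The weights of \<open>h\<^sub>1 + h\<^sub>2\<close> then leave
  three possibilities for \<open>N\<close>. The five subalgebras are told apart by whether they stabilise a line,
  whether they stabilise a plane, and whether they consist of singular matrices.
\<close>

section \<open>Abelian ideals and solvability\<close>

text \<open>No structure theory of semisimple algebras enters. Of the semisimplicity of
  \<open>U\<close> one consequence is kept: an ideal of \<open>U\<close> whose brackets all commute
  with one another is zero. It is used twice: for the kernel of the projection of \<open>U\<close>
  to the block, where all brackets lie in the abelian span of \<open>x\<^sub>1\<close> and
  \<open>y\<^sub>2\<close>, and for \<open>U\<close> itself, should the projection not be onto.
  Lifts of the standard triple then satisfy the relations of sl_2 exactly, and these relations leave
  just two free parameters \<open>p\<close> and \<open>q\<close>. The unipotent conjugating matrix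
  is written down from them, which takes the place of complete reducibility. A weight space of
  \<open>W\<close> cannot be all of the 3-dimensional space, since a traceless scalar matrix is
  zero; so its dimension is 1 or 2, and a line or a plane is all that can occur. Each of the two
  dual cases has three outcomes. The duality fixes \<open>block_gl\<close>, which both cases share,
  so the list has five members.\<close>

lemma lie_algebraD:
  assumes "lie_algebra G"
  shows "vector_space (lie_scale G)"
    and "module.subspace (lie_scale G) (lie_carrier G)"
    and "a \<in> lie_carrier G \<Longrightarrow> b \<in> lie_carrier G \<Longrightarrow> lie_bracket G a b \<in> lie_carrier G"
    and "a \<in> lie_carrier G \<Longrightarrow> b \<in> lie_carrier G \<Longrightarrow> c \<in> lie_carrier G \<Longrightarrow>
      lie_bracket G (a + b) c = lie_bracket G a c + lie_bracket G b c"
    and "a \<in> lie_carrier G \<Longrightarrow> b \<in> lie_carrier G \<Longrightarrow> c \<in> lie_carrier G \<Longrightarrow>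
      lie_bracket G a (b + c) = lie_bracket G a b + lie_bracket G a c"
    and "a \<in> lie_carrier G \<Longrightarrow> b \<in> lie_carrier G \<Longrightarrow>
      lie_bracket G (lie_scale G k a) b = lie_scale G k (lie_bracket G a b)"
    and "a \<in> lie_carrier G \<Longrightarrow> b \<in> lie_carrier G \<Longrightarrow>
      lie_bracket G a (lie_scale G k b) = lie_scale G k (lie_bracket G a b)"
    and "a \<in> lie_carrier G \<Longrightarrow> lie_bracket G a a = 0"
    and "a \<in> lie_carrier G \<Longrightarrow> b \<in> lie_carrier G \<Longrightarrow> c \<in> lie_carrier G \<Longrightarrow>
      lie_bracket G a (lie_bracket G b c) + lie_bracket G b (lie_bracket G c a)
        + lie_bracket G c (lie_bracket G a b) = 0"
  using assms by (simp_all add: lie_algebra_def)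

lemma lie_algebra_subalgebra:
  assumes "lie_algebra G" "lie_subalgebra K G"
  shows "lie_algebra (G\<lparr>lie_carrier := K\<rparr>)"
  using assms by (auto simp: lie_algebra_def lie_subalgebra_def subset_iff)

lemma lie_ideal_imp_subalgebra: "lie_ideal I G \<Longrightarrow> lie_subalgebra I G"
  by (auto simp: lie_ideal_def lie_subalgebra_def)

lemma lie_bracket_anticomm:
  assumes G: "lie_algebra G" and ab: "a \<in> lie_carrier G" "b \<in> lie_carrier G"
  shows "lie_bracket G a b = - lie_bracket G b a"
proof -
  interpret vector_space "lie_scale G" by (rule lie_algebraD(1)[OF G])
  have "a + b \<in> lie_carrier G" using lie_algebraD(2)[OF G] ab by (rule subspace_add)
  then have "lie_bracket G (a + b) (a + b) = 0" by (rule lie_algebraD(8)[OF G])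
  moreover have "lie_bracket G (a + b) (a + b) = lie_bracket G a b + lie_bracket G b a"
    unfolding lie_algebraD(4)[OF G ab \<open>a + b \<in> _\<close>] lie_algebraD(5)[OF G ab(1) ab]
      lie_algebraD(5)[OF G ab(2) ab] using ab by (simp add: lie_algebraD(8)[OF G])
  ultimately show ?thesis by (simp add: eq_neg_iff_add_eq_0)
qed

text \<open>By the Jacobi identity, a bracket of \<open>c\<close> with \<open>[a, b]\<close> is a
  sum of brackets of \<open>a\<close> with \<open>[b, c]\<close> and of \<open>b\<close> with
  \<open>[c, a]\<close>, whose entries stay in the previous term by induction. Linearity extends
  this from brackets to their span.\<close>

lemma lie_ideal_derived_series:
  assumes G: "lie_algebra G" and V: "lie_ideal V G"
  shows "lie_ideal (derived_series (G\<lparr>lie_carrier := V\<rparr>) n) G"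
proof (induction n)
  case 0
  then show ?case using V by simp
next
  case (Suc n)
  interpret vector_space "lie_scale G" by (rule lie_algebraD(1)[OF G])
  define D where "D = derived_series (G\<lparr>lie_carrier := V\<rparr>) n"
  define B where "B = {lie_bracket G a b | a b. a \<in> D \<and> b \<in> D}"
  have D: "D \<subseteq> lie_carrier G" "subspace D"
    and DI: "\<And>c a. c \<in> lie_carrier G \<Longrightarrow> a \<in> D \<Longrightarrow> lie_bracket G c a \<in> D"
    using Suc by (auto simp: lie_ideal_def D_def)
  have "B \<subseteq> lie_carrier G"
    using D(1) lie_algebraD(3)[OF G] by (auto simp: B_def)
  then have sub: "span B \<subseteq> lie_carrier G"
    using lie_algebraD(2)[OF G] by (rule span_minimal)
  have "lie_bracket G c u \<in> span B" if c: "c \<in> lie_carrier G" and "u \<in> span B" for c u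
  proof -
    have "u \<in> {u \<in> lie_carrier G. lie_bracket G c u \<in> span B}" (is "_ \<in> ?S")
      using \<open>u \<in> span B\<close>
    proof (rule set_mp[OF span_minimal, rotated 2])
      show "subspace ?S"
      proof (rule subspaceI)
        have "0 \<in> lie_carrier G" using lie_algebraD(2)[OF G] by (rule subspace_0)
        moreover from this have "lie_bracket G c 0 = 0"
          using lie_algebraD(7)[OF G c, of 0 0] by simp
        ultimately show "0 \<in> ?S" by (simp add: span_zero)
      next
        fix u v assume "u \<in> ?S" "v \<in> ?S"
        then show "u + v \<in> ?S"
          using subspace_add[OF lie_algebraD(2)[OF G]]
          by (auto simp: lie_algebraD(5)[OF G c] span_add)
      next
        fix k u assume "u \<in> ?S"
        then show "lie_scale G k u \<in> ?S"
          using subspace_scale[OF lie_algebraD(2)[OF G]]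
          by (auto simp: lie_algebraD(7)[OF G c] span_scale)
      qed
      show "B \<subseteq> ?S"
      proof
        fix u assume "u \<in> B"
        then obtain a b where u: "u = lie_bracket G a b" "a \<in> D" "b \<in> D" by (auto simp: B_def)
        have ab: "a \<in> lie_carrier G" "b \<in> lie_carrier G" using u D by auto
        have "lie_bracket G b c = - lie_bracket G c b"
          by (rule lie_bracket_anticomm[OF G ab(2) c])
        then have "lie_bracket G b c \<in> D"
          using subspace_neg[OF D(2) DI[OF c u(3)]] by simp
        then have "lie_bracket G a (lie_bracket G b c) \<in> span B"
          using u by (auto simp: B_def intro!: span_base)
        moreover have "lie_bracket G b (lie_bracket G c a) \<in> span B"
          using u DI[OF c u(2)] by (auto simp: B_def intro!: span_base)
        moreover have "lie_bracket G c u =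
            - (lie_bracket G a (lie_bracket G b c) + lie_bracket G b (lie_bracket G c a))"
          using lie_algebraD(9)[OF G ab c] unfolding u(1) by (metis neg_eq_iff_add_eq_0)
        ultimately show "u \<in> ?S"
          using u ab lie_algebraD(3)[OF G] by (auto intro!: span_neg span_diff)
      qed
    qed
    then show ?thesis by simp
  qed
  then show ?case
    using sub by (simp add: lie_ideal_def B_def D_def)
qed

lemma derived_series_subset:
  assumes G: "lie_algebra G" and V: "lie_ideal V G"
  shows "derived_series (G\<lparr>lie_carrier := V\<rparr>) n \<subseteq> V"
proof -
  let ?H = "G\<lparr>lie_carrier := V\<rparr>"
  have H: "lie_algebra ?H" using lie_algebra_subalgebra[OF G lie_ideal_imp_subalgebra[OF V]] .
  \<comment> \<open>Here \<open>V\<close> is an ideal of itself, so that containment in the ambient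
    carrier becomes containment in \<open>V\<close>.\<close>
  have "lie_ideal V ?H"
    using V by (auto simp: lie_ideal_def)
  from lie_ideal_derived_series[OF H this, of n] show ?thesis
    by (simp add: lie_ideal_def)
qed

text \<open>The ideal found here is the last nonzero term of the derived series.\<close>

lemma solvable_ideal_has_abelian_ideal:
  assumes G: "lie_algebra G" and V: "lie_ideal V G" "V \<noteq> {0}"
    and solv: "lie_solvable (G\<lparr>lie_carrier := V\<rparr>)"
  obtains W where "lie_ideal W G" "W \<subseteq> V" "W \<noteq> {0}"
    "\<And>a b. a \<in> W \<Longrightarrow> b \<in> W \<Longrightarrow> lie_bracket G a b = 0"
proof -
  interpret vector_space "lie_scale G" by (rule lie_algebraD(1)[OF G])
  define D where "D = derived_series (G\<lparr>lie_carrier := V\<rparr>)"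
  define n where "n = (LEAST n. D n = {0})"
  have Dn: "D n = {0}"
    unfolding n_def
  proof (rule LeastI_ex)
    show "\<exists>n. D n = {0}" using solv by (simp add: lie_solvable_def D_def)
  qed
  have "D 0 = V" by (simp add: D_def)
  then have "n \<noteq> 0" using Dn V(2) by metis
  then obtain m where m: "n = Suc m" by (cases n) auto
  have "D m \<noteq> {0}" using m not_less_Least[of m "\<lambda>n. D n = {0}"] unfolding n_def[symmetric] m by blast
  moreover have "lie_bracket G a b = 0" if "a \<in> D m" "b \<in> D m" for a b
  proof -
    have "lie_bracket G a b \<in> span {lie_bracket G a b | a b. a \<in> D m \<and> b \<in> D m}"
      using that by (auto intro!: span_base)
    then show ?thesis using Dn by (simp add: m D_def)
  qed
  ultimately show ?thesis
    using that[of "D m"] lie_ideal_derived_series[OF G V(1), of m]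
      derived_series_subset[OF G V(1), of m] unfolding D_def by blast
qed

text \<open>The hypothesis concerns single brackets, while the derived series takes spans.
  Bilinearity passes to the spans one argument at a time, and the second derived term is then
  zero.\<close>

lemma lie_solvable_two_step:
  assumes G: "lie_algebra G" and K: "lie_subalgebra K G"
    and comm: "\<And>a b c d. \<lbrakk>a \<in> K; b \<in> K; c \<in> K; d \<in> K\<rbrakk> \<Longrightarrow>
      lie_bracket G (lie_bracket G a b) (lie_bracket G c d) = 0"
  shows "lie_solvable (G\<lparr>lie_carrier := K\<rparr>)"
proof -
  interpret vector_space "lie_scale G" by (rule lie_algebraD(1)[OF G])
  note GD = lie_algebraD[OF lie_algebra_subalgebra[OF G K], simplified]
  define B where "B = {lie_bracket G a b | a b. a \<in> K \<and> b \<in> K}"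
  have BK: "span B \<subseteq> K"
    using GD(2,3) by (intro span_minimal) (auto simp: B_def)
  have K0: "0 \<in> K" using GD(2) by (rule subspace_0)
  have left: "lie_bracket G u v = 0" if u: "u \<in> span B" and v: "v \<in> B" for u v
  proof -
    have vK: "v \<in> K" using v BK span_superset by blast
    have "u \<in> {u \<in> K. lie_bracket G u v = 0}"
      using u
    proof (rule set_mp[OF span_minimal, rotated 2])
      show "B \<subseteq> {u \<in> K. lie_bracket G u v = 0}"
        using v comm BK span_superset by (fastforce simp: B_def)
      show "subspace {u \<in> K. lie_bracket G u v = 0}"
      proof (rule subspaceI)
        have "lie_bracket G 0 v = 0"
          using GD(6)[OF K0 vK, of 0] by simp
        then show "0 \<in> {u \<in> K. lie_bracket G u v = 0}" using K0 by simp
      qed (use GD(2) vK in \<open>auto simp: GD(4,6) subspace_add subspace_scale\<close>)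
    qed
    then show ?thesis by simp
  qed
  have "lie_bracket G u v = 0" if u: "u \<in> span B" and v: "v \<in> span B" for u v
  proof -
    have uK: "u \<in> K" using u BK by blast
    have "v \<in> {v \<in> K. lie_bracket G u v = 0}"
      using v
    proof (rule set_mp[OF span_minimal, rotated 2])
      show "B \<subseteq> {v \<in> K. lie_bracket G u v = 0}"
        using left[OF u] BK span_superset by blast
      show "subspace {v \<in> K. lie_bracket G u v = 0}"
      proof (rule subspaceI)
        have "lie_bracket G u 0 = 0"
          using GD(7)[OF uK K0, of 0] by simp
        then show "0 \<in> {v \<in> K. lie_bracket G u v = 0}" using K0 by simp
      qed (use GD(2) uK in \<open>auto simp: GD(5,7) subspace_add subspace_scale\<close>)
    qed
    then show ?thesis by simp
  qed
  then have "{lie_bracket G a b | a b. a \<in> span B \<and> b \<in> span B} \<subseteq> {0}" by blast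
  from span_minimal[OF this subspace_single_0]
  have "span {lie_bracket G a b | a b. a \<in> span B \<and> b \<in> span B} = {0}"
    using span_zero by blast
  then have "derived_series (G\<lparr>lie_carrier := K\<rparr>) (Suc (Suc 0)) = {0}"
    by (simp add: B_def)
  then show ?thesis unfolding lie_solvable_def by blast
qed

section \<open>Reducibility of subalgebras with an abelian ideal\<close>

definition stable_line :: "(complex^3^3) set \<Rightarrow> bool" where
  "stable_line N \<longleftrightarrow> (\<exists>v. v \<noteq> 0 \<and> (\<forall>A\<in>N. \<exists>c. A *v v = c *s v))"

text \<open>A plane is given by a linear form \<open>w\<close>, unique up to a factor, that vanishes on it.\<close>

definition stable_plane :: "(complex^3^3) set \<Rightarrow> bool" where
  "stable_plane N \<longleftrightarrow> (\<exists>w. w \<noteq> 0 \<and> (\<forall>A\<in>N. \<exists>c. w v* A = c *s w))"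

lemmas coords_3 = vec_eq_iff forall_3 matrix_matrix_mult_def matrix_vector_mult_def
  vector_matrix_mult_def transpose_def mat_def trace_def sum_3 mscale_def

section \<open>Eigenvectors of commuting matrices of size 3\<close>

text \<open>The Cayley-Hamilton identity with its coefficients expressed by power sums (Newton's
  identities) and multiplied by 6 to clear denominators. In this form, vanishing traces of the first
  three powers give nilpotency at once.\<close>

lemma cayley_hamilton_3:
  fixes A :: "complex^3^3"
  defines "t \<equiv> trace A" and "t2 \<equiv> trace (A ** A)" and "t3 \<equiv> trace (A ** (A ** A))"
  shows "6 *s (A *v (A *v (A *v v))) = (6 * t) *s (A *v (A *v v))
    - (3 * (t\<^sup>2 - t2)) *s (A *v v) + (t ^ 3 - 3 * t * t2 + 2 * t3) *s v"
  unfolding t_def t2_def t3_def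
  by (simp add: coords_3, intro conjI; algebra)

lemma monic_cubic_splits:
  fixes p q r :: complex
  obtains a b c where "p = a + b + c" "q = a * b + b * c + c * a" "r = a * b * c"
proof -
  have "\<not> constant (poly [:- r, q, - p, 1:])"
    by (simp add: constant_degree)
  from fundamental_theorem_of_algebra[OF this] obtain a where "poly [:- r, q, - p, 1:] a = 0" by blast
  then have a: "r = a * q - a * a * p + a * a * a" by (simp add: algebra_simps)
  \<comment> \<open>A square root of the discriminant of the quadratic that remains after division
    by the root \<open>a\<close>.\<close>
  define s where "s = csqrt ((p - a)\<^sup>2 - 4 * (q - a * (p - a)))"
  have s: "s * s = (p - a)\<^sup>2 - 4 * (q - a * (p - a))"
    unfolding s_def power2_eq_square[symmetric] by simp
  have "4 * (((p - a + s) / 2) * ((p - a - s) / 2)) = (p - a)\<^sup>2 - s * s"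
    by (simp add: field_simps power2_eq_square)
  then have prod: "((p - a + s) / 2) * ((p - a - s) / 2) = q - a * (p - a)"
    unfolding s by simp
  show ?thesis
  proof (rule that[of a "(p - a + s) / 2" "(p - a - s) / 2"])
    show "p = a + (p - a + s) / 2 + (p - a - s) / 2" by (simp add: field_simps)
    then show "q = a * ((p - a + s) / 2) + (p - a + s) / 2 * ((p - a - s) / 2) + (p - a - s) / 2 * a"
      unfolding prod by (simp add: field_simps)
    show "r = a * ((p - a + s) / 2) * ((p - a - s) / 2)"
      unfolding mult.assoc prod a by (simp add: field_simps)
  qed
qed

lemma matrix_vector_cmult [simp]: "A *v (c *s v) = c *s (A *v (v :: complex^3))"
  by (simp add: vec_eq_iff matrix_vector_mult_def sum_distrib_left algebra_simps)

text \<open>With \<open>a\<close>, \<open>b\<close>, \<open>c\<close> the roots of the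
  characteristic polynomial, \<open>(A - a)(A - b)(A - c) v = 0\<close>. Applying the factors one by
  one, the last vector before zero is an eigenvector, and stability keeps it in
  \<open>S\<close>.\<close>

lemma eigenvector_in_stable_subspace:
  fixes A :: "complex^3^3"
  assumes S: "vec.subspace S" "S \<noteq> {0}" and stable: "\<And>v. v \<in> S \<Longrightarrow> A *v v \<in> S"
  obtains a v where "v \<in> S" "v \<noteq> 0" "A *v v = a *s v"
proof -
  define t t2 t3 where "t = trace A" and "t2 = trace (A ** A)" and "t3 = trace (A ** (A ** A))"
  obtain a b c where abc: "t = a + b + c" "(t\<^sup>2 - t2) / 2 = a * b + b * c + c * a"
      "(t ^ 3 - 3 * t * t2 + 2 * t3) / 6 = a * b * c"
    using monic_cubic_splits .
  have e: "6 * t = 6 * (a + b + c)" "3 * (t\<^sup>2 - t2) = 6 * (a * b + b * c + c * a)"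
    "t ^ 3 - 3 * t * t2 + 2 * t3 = 6 * (a * b * c)"
    using abc by (simp_all add: field_simps)
  obtain v where v: "v \<in> S" "v \<noteq> 0" using S vec.subspace_0 by blast
  define v1 where "v1 = A *v v - c *s v"
  define v2 where "v2 = A *v v1 - b *s v1"
  have "6 *s (A *v v2 - a *s v2) = 0"
    using cayley_hamilton_3[of A v, folded t_def t2_def t3_def] unfolding v2_def v1_def e
    by (simp add: matrix_vector_mult_diff_distrib vec_eq_iff algebra_simps)
  then have v2: "A *v v2 = a *s v2" by (metis eq_iff_diff_eq_0 vec.scale_eq_0_iff zero_neq_numeral)
  have "v1 \<in> S" "v2 \<in> S"
    using v stable S by (auto simp: v1_def v2_def intro!: vec.subspace_diff vec.subspace_scale)
  show ?thesis
  proof (cases "v1 = 0")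
    case True
    then show ?thesis using that[of v c] v by (simp add: v1_def)
  next
    case False
    then show ?thesis
      using that[of v1 b] that[of v2 a] v2 \<open>v1 \<in> S\<close> \<open>v2 \<in> S\<close>
      by (cases "v2 = 0") (auto simp: v2_def)
  qed
qed

text \<open>In a nonzero stable subspace \<open>S\<close> of least dimension, an eigenspace of a
  member of \<open>W\<close> is nonzero and, by commutativity, stable under \<open>W\<close>.
  Minimality makes it all of \<open>S\<close>, so every member of \<open>W\<close> acts on
  \<open>S\<close> as a scalar.\<close>

lemma common_eigenvector:
  fixes W :: "(complex^3^3) set"
  assumes comm: "\<And>A B. A \<in> W \<Longrightarrow> B \<in> W \<Longrightarrow> A ** B = B ** A"
  obtains v l where "v \<noteq> 0" "\<And>A. A \<in> W \<Longrightarrow> A *v v = l A *s v"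
proof -
  define P where "P S \<longleftrightarrow> vec.subspace S \<and> S \<noteq> {0} \<and> (\<forall>A\<in>W. \<forall>v\<in>S. A *v v \<in> S)"
    for S :: "(complex^3) set"
  have "axis 1 1 \<noteq> (0 :: complex^3)" by (simp add: axis_eq_0_iff)
  then have "P UNIV" by (auto simp: P_def)
  then obtain S where S: "P S" and min: "\<And>T. P T \<Longrightarrow> vec.dim S \<le> vec.dim T"
    using ex_has_least_nat[of P UNIV vec.dim] by blast
  have Ssub: "vec.subspace S" and S0: "S \<noteq> {0}" using S by (auto simp: P_def)
  have "\<exists>a. \<forall>v\<in>S. A *v v = a *s v" if A: "A \<in> W" for A
  proof -
    have "\<And>v. v \<in> S \<Longrightarrow> A *v v \<in> S" using S A by (auto simp: P_def)
    from eigenvector_in_stable_subspace[OF Ssub S0 this]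
    obtain a v where v: "v \<in> S" "v \<noteq> 0" "A *v v = a *s v" by metis
    define T where "T = {v\<in>S. A *v v = a *s v}"
    have "vec.subspace T"
      using Ssub by (auto simp: T_def vec.subspace_def matrix_vector_right_distrib
          vector_add_ldistrib vec_eq_iff algebra_simps)
    moreover have "B *v u \<in> T" if "B \<in> W" "u \<in> T" for B u
    proof -
      have "A *v (B *v u) = B *v (A *v u)"
        using comm[OF A \<open>B \<in> W\<close>] by (simp add: matrix_vector_mul_assoc)
      then show ?thesis using that S by (auto simp: T_def P_def)
    qed
    ultimately have "P T" using v by (auto simp: P_def T_def)
    moreover have "T \<subseteq> S" by (auto simp: T_def)
    ultimately have "T = S"
      using vec.subspace_dim_equal[of T S] min Ssub by (auto simp: P_def)
    then show ?thesis by (auto simp: T_def)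
  qed
  then obtain l where "\<And>A v. A \<in> W \<Longrightarrow> v \<in> S \<Longrightarrow> A *v v = l A *s v" by metis
  moreover obtain v where "v \<in> S" "v \<noteq> 0" using Ssub S0 vec.subspace_0 by blast
  ultimately show ?thesis using that by blast
qed

section \<open>Nilpotent commutators and stable weight spaces\<close>

text \<open>Cyclicity of the trace. Taking for \<open>B\<close> the identity, the commutator and its
  square shows that the first three powers of a commutator that commutes with \<open>A\<close> have
  trace zero.\<close>

lemma trace_commutator_mult:
  fixes A B X :: "complex^'n^'n"
  assumes "A ** B = B ** A"
  shows "trace (B ** (A ** X - X ** A)) = 0"
proof -
  have "B ** (A ** X - X ** A) = B ** (A ** X) - B ** (X ** A)"
    by (simp add: vec_eq_iff matrix_matrix_mult_def right_diff_distrib sum_subtractf)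
  then have "trace (B ** (A ** X - X ** A)) = trace (A ** (B ** X)) - trace ((B ** X) ** A)"
    by (simp add: matrix_mul_assoc assms trace_sub)
  then show ?thesis using trace_mul_sym[of A "B ** X"] by simp
qed

text \<open>
  All powers of \<open>B\<close> have trace zero, so \<open>B\<close> is nilpotent.
\<close>

lemma commuting_commutator_eigenvalue:
  fixes A B X :: "complex^3^3"
  assumes B: "B = A ** X - X ** A" and comm: "A ** B = B ** A"
    and v: "B *v v = c *s v" "v \<noteq> 0"
  shows "c = 0"
proof -
  have "trace B = 0"
    using trace_commutator_mult[of A "mat 1" X] by (simp add: B)
  moreover have "trace (B ** B) = 0"
    using trace_commutator_mult[OF comm, of X] by (simp add: B)
  moreover have "A ** (B ** B) = (B ** B) ** A"
    using comm by (metis matrix_mul_assoc)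
  from trace_commutator_mult[OF this, of X] have "trace (B ** (B ** B)) = 0"
    by (simp add: B[symmetric] matrix_mul_assoc)
  ultimately have "6 *s (B *v (B *v (B *v v))) = 0"
    using cayley_hamilton_3[of B v] by simp
  then show ?thesis using v by simp
qed

text \<open>
  The weight space of a common eigenvector of the ideal is stable and proper. If it is a plane, the
  linear form \<open>w\<close> that vanishes on it is the cross product of two of its vectors.
\<close>

lemma stable_line_or_plane:
  fixes N W :: "(complex^3^3) set"
  assumes ideal: "\<And>X A. X \<in> N \<Longrightarrow> A \<in> W \<Longrightarrow> X ** A - A ** X \<in> W"
    and "W \<subseteq> N" and comm: "\<And>A B. A \<in> W \<Longrightarrow> B \<in> W \<Longrightarrow> A ** B = B ** A"
    and tr: "\<And>A. A \<in> W \<Longrightarrow> trace A = 0" and neg: "\<And>A. A \<in> W \<Longrightarrow> - A \<in> W"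
    and nz: "A0 \<in> W" "A0 \<noteq> 0"
  shows "stable_line N \<or> stable_plane N"
proof -
  obtain v0 l where v0: "v0 \<noteq> 0" "\<And>A. A \<in> W \<Longrightarrow> A *v v0 = l A *s v0"
    using common_eigenvector[OF comm] by blast
  define E where "E = {v. \<forall>A\<in>W. A *v v = l A *s v}"
  have E_add: "u + v \<in> E" if "u \<in> E" "v \<in> E" for u v
    using that by (simp add: E_def matrix_vector_right_distrib vector_add_ldistrib)
  have E_scale: "k *s v \<in> E" if "v \<in> E" for k v
    using that by (simp add: E_def vec_eq_iff algebra_simps)
  have stable: "X *v v \<in> E" if X: "X \<in> N" and v: "v \<in> E" for X v
    unfolding E_def
  proof (intro CollectI ballI)
    fix A assume A: "A \<in> W"
    define B where "B = A ** X - X ** A"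
    have "B \<in> W" using neg[OF ideal[OF X A]] by (simp add: B_def)
    \<comment> \<open>\<open>B\<close> lies in the abelian set \<open>W\<close> and is nilpotent,
      and \<open>l B\<close> is its eigenvalue at \<open>v0\<close>.\<close>
    have "l B = 0"
      using commuting_commutator_eigenvalue[OF B_def comm[OF A \<open>B \<in> W\<close>] v0(2)[OF \<open>B \<in> W\<close>] v0(1)] .
    then have "B *v v = 0" using v \<open>B \<in> W\<close> by (simp add: E_def)
    then have "A *v (X *v v) = X *v (A *v v)"
      by (simp add: B_def matrix_vector_mult_diff_rdistrib matrix_vector_mul_assoc)
    then show "A *v (X *v v) = l A *s (X *v v)" using v A by (simp add: E_def)
  qed
  \<comment> \<open>Otherwise \<open>A0\<close> would be a scalar matrix of trace zero.\<close>
  have E_proper: "\<exists>v. v \<notin> E"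
  proof (rule ccontr)
    assume "\<not> ?thesis"
    then have A0v: "A0 *v v = l A0 *s v" for v using nz(1) by (auto simp: E_def)
    have "A0 = mat (l A0)"
      unfolding matrix_eq A0v by (simp add: coords_3)
    then have "trace (mat (l A0) :: complex^3^3) = 0" using tr[OF nz(1)] by simp
    then have "l A0 = 0" by (simp add: coords_3)
    then show False using nz(2) \<open>A0 = mat (l A0)\<close> by (simp add: coords_3)
  qed
  \<comment> \<open>Cross product and bilinear dot product, without complex conjugation, so that a
    linear form is represented by a vector.\<close>
  define cr where "cr u v = (vector [u$2 * v$3 - u$3 * v$2, u$3 * v$1 - u$1 * v$3,
    u$1 * v$2 - u$2 * v$1] :: complex^3)" for u v :: "complex^3"
  define dt where "dt u v = u$1 * v$1 + u$2 * v$2 + u$3 * v$3" for u v :: "complex^3"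
  have parallel: "\<exists>c. v = c *s u" if "u \<noteq> 0" "cr u v = 0" for u v
  proof -
    consider "u$1 \<noteq> 0" | "u$2 \<noteq> 0" | "u$3 \<noteq> 0" using \<open>u \<noteq> 0\<close> by (auto simp: vec_eq_iff forall_3)
    then show ?thesis
    proof cases
      case 1
      then have "v = (v$1 / u$1) *s u" using that(2)
        by (simp add: vec_eq_iff forall_3 cr_def field_simps)
      then show ?thesis by blast
    next
      case 2
      then have "v = (v$2 / u$2) *s u" using that(2)
        by (simp add: vec_eq_iff forall_3 cr_def field_simps)
      then show ?thesis by blast
    next
      case 3
      then have "v = (v$3 / u$3) *s u" using that(2)
        by (simp add: vec_eq_iff forall_3 cr_def field_simps)
      then show ?thesis by blast
    qed
  qed
  show ?thesis
  proof (cases "\<exists>u\<in>E. \<exists>v\<in>E. cr u v \<noteq> 0")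
    case False
    have "v0 \<in> E" using v0 by (simp add: E_def)
    then have "\<exists>c. A *v v0 = c *s v0" if "A \<in> N" for A
      using parallel[OF v0(1)] stable[OF that] False by blast
    then show ?thesis using v0(1) by (auto simp: stable_line_def)
  next
    case True
    then obtain u v where uv: "u \<in> E" "v \<in> E" "cr u v \<noteq> 0" by blast
    define w where "w = cr u v"
    have ortho: "dt w z = 0" if z: "z \<in> E" for z
    proof (rule ccontr)
      assume d: "dt w z \<noteq> 0"
      have "y \<in> E" for y
      proof -
        \<comment> \<open>Cramer's rule: \<open>dt w z\<close> is the determinant of
          \<open>u\<close>, \<open>v\<close>, \<open>z\<close>. If it is nonzero, these members of
          \<open>E\<close> span the whole space.\<close>
        have "dt w z *s y = dt (cr v z) y *s u + dt (cr z u) y *s v + dt w y *s z"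
          by (simp add: w_def vec_eq_iff forall_3 cr_def dt_def algebra_simps)
        also have "\<dots> \<in> E" by (intro E_add E_scale uv z)
        finally have "inverse (dt w z) *s (dt w z *s y) \<in> E" by (rule E_scale)
        then show "y \<in> E" using d by simp
      qed
      then show False using E_proper by blast
    qed
    have "\<exists>c. w v* A = c *s w" if A: "A \<in> N" for A
    proof (rule parallel)
      show "w \<noteq> 0" using uv by (simp add: w_def)
      \<comment> \<open>The form \<open>w v* A\<close> vanishes on \<open>u\<close> and
        \<open>v\<close>, because \<open>A\<close> keeps both in \<open>E\<close>. Expanding the
        triple product \<open>(u x v) x z\<close> then shows that it is parallel to
        \<open>w\<close>.\<close>
      have adj: "dt (w v* A) z = dt w (A *v z)" for z
        by (simp add: dt_def coords_3 algebra_simps)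
      have "dt (w v* A) u = 0" "dt (w v* A) v = 0"
        unfolding adj using ortho[OF stable[OF A]] uv by auto
      moreover have "cr w z = dt z u *s v - dt z v *s u" for z
        by (simp add: w_def vec_eq_iff forall_3 cr_def dt_def algebra_simps)
      ultimately show "cr w (w v* A) = 0" by simp
    qed
    then show ?thesis using uv by (auto simp: stable_plane_def w_def)
  qed
qed

section \<open>Levi pairs and isomorphisms\<close>

lemma lie_homD:
  assumes "lie_hom f G H"
  shows "a \<in> lie_carrier G \<Longrightarrow> f a \<in> lie_carrier H"
    and "a \<in> lie_carrier G \<Longrightarrow> b \<in> lie_carrier G \<Longrightarrow> f (a + b) = f a + f b"
    and "a \<in> lie_carrier G \<Longrightarrow> f (lie_scale G k a) = lie_scale H k (f a)"
    and "a \<in> lie_carrier G \<Longrightarrow> b \<in> lie_carrier G \<Longrightarrow>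
      f (lie_bracket G a b) = lie_bracket H (f a) (f b)"
  using assms by (auto simp: lie_hom_def)

lemma lie_hom_0:
  assumes "lie_algebra G" "lie_hom f G H"
  shows "f 0 = 0"
proof -
  interpret vector_space "lie_scale G" by (rule lie_algebraD(1)[OF assms(1)])
  have "0 \<in> lie_carrier G" using lie_algebraD(2)[OF assms(1)] by (rule subspace_0)
  then have "f 0 = f 0 + f 0" using lie_homD(2)[OF assms(2), of 0 0] by simp
  then show ?thesis by simp
qed

lemma lie_subalgebraD:
  assumes "lie_algebra G" "lie_subalgebra K G"
  shows "K \<subseteq> lie_carrier G" "0 \<in> K"
    and "a \<in> K \<Longrightarrow> b \<in> K \<Longrightarrow> a + b \<in> K"
    and "a \<in> K \<Longrightarrow> lie_scale G k a \<in> K"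
    and "a \<in> K \<Longrightarrow> b \<in> K \<Longrightarrow> lie_bracket G a b \<in> K"
proof -
  interpret vector_space "lie_scale G" by (rule lie_algebraD(1)[OF assms(1)])
  show "K \<subseteq> lie_carrier G" "0 \<in> K"
    "a \<in> K \<Longrightarrow> b \<in> K \<Longrightarrow> a + b \<in> K"
    "a \<in> K \<Longrightarrow> lie_scale G k a \<in> K"
    "a \<in> K \<Longrightarrow> b \<in> K \<Longrightarrow> lie_bracket G a b \<in> K"
    using assms(2) by (auto simp: lie_subalgebra_def subspace_0 subspace_add subspace_scale)
qed

lemma lie_subalgebraI:
  assumes "lie_algebra G" "K \<subseteq> lie_carrier G" "0 \<in> K"
    and "\<And>a b. a \<in> K \<Longrightarrow> b \<in> K \<Longrightarrow> a + b \<in> K"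
    and "\<And>k a. a \<in> K \<Longrightarrow> lie_scale G k a \<in> K"
    and "\<And>a b. a \<in> K \<Longrightarrow> b \<in> K \<Longrightarrow> lie_bracket G a b \<in> K"
  shows "lie_subalgebra K G"
proof -
  interpret vector_space "lie_scale G" by (rule lie_algebraD(1)[OF assms(1)])
  show ?thesis using assms by (auto simp: lie_subalgebra_def intro!: subspaceI)
qed

lemma lie_subalgebra_image:
  assumes G: "lie_algebra G" and H: "lie_algebra H" and f: "lie_hom f G H"
    and K: "lie_subalgebra K G"
  shows "lie_subalgebra (f ` K) H"
proof -
  note KD = lie_subalgebraD[OF G K] and fD = lie_homD[OF f]
  have carr: "\<And>a. a \<in> K \<Longrightarrow> a \<in> lie_carrier G" using KD(1) by blast
  show ?thesis
  proof (rule lie_subalgebraI[OF H])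
    show "f ` K \<subseteq> lie_carrier H" using fD(1) carr by blast
    show "0 \<in> f ` K" using lie_hom_0[OF G f] KD(2) by (metis image_eqI)
  next
    fix a b assume "a \<in> f ` K" "b \<in> f ` K"
    then obtain a' b' where ab: "a = f a'" "b = f b'" "a' \<in> K" "b' \<in> K" by blast
    show "a + b \<in> f ` K" using ab KD(3) fD(2) carr by (metis image_eqI)
    show "lie_bracket H a b \<in> f ` K" using ab KD(5) fD(4) carr by (metis image_eqI)
  next
    fix k a assume "a \<in> f ` K"
    then obtain a' where "a = f a'" "a' \<in> K" by blast
    then show "lie_scale H k a \<in> f ` K" using KD(4) fD(3) carr by (metis image_eqI)
  qed
qed

text \<open>A pointwise identity in place of the derived series: it pulls back along an injective
  homomorphism by evaluation, and \<open>lie_solvable_two_step\<close> leads from it to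
  solvability.\<close>

definition two_step_solvable :: "'a::ab_group_add lie \<Rightarrow> 'a set \<Rightarrow> bool" where
  "two_step_solvable G K \<longleftrightarrow> (\<forall>a\<in>K. \<forall>b\<in>K. \<forall>c\<in>K. \<forall>d\<in>K.
     lie_bracket G (lie_bracket G a b) (lie_bracket G c d) = 0)"

text \<open>
  What remains of a Levi decomposition \<open>N = U + V\<close>: the part of the semisimplicity of \<open>U\<close> that the
  classification uses, and \<open>V \<noteq> {0}\<close> in the form \<open>U \<noteq> N\<close>.
\<close>

definition levi_pair :: "'a::ab_group_add lie \<Rightarrow> 'a set \<Rightarrow> 'a set \<Rightarrow> bool" where
  "levi_pair G U N \<longleftrightarrow> lie_subalgebra N G \<and> lie_subalgebra U G \<and> U \<subset> N \<and> U \<noteq> {0} \<and>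
     (\<forall>K. lie_ideal K (G\<lparr>lie_carrier := U\<rparr>) \<and> two_step_solvable G K \<longrightarrow> K = {0})"

lemma levi_decomposable_imp_levi_pair:
  assumes G: "lie_algebra G" and N: "lie_subalgebra N G"
    and levi: "levi_decomposable (G\<lparr>lie_carrier := N\<rparr>)"
  obtains U W where "levi_pair G U N" "lie_ideal W (G\<lparr>lie_carrier := N\<rparr>)" "W \<noteq> {0}"
    "\<And>a b. a \<in> W \<Longrightarrow> b \<in> W \<Longrightarrow> lie_bracket G a b = 0"
proof -
  let ?N = "G\<lparr>lie_carrier := N\<rparr>"
  have GN: "lie_algebra ?N" using lie_algebra_subalgebra[OF G N] .
  obtain U V where UV: "is_semidirect_sum ?N U V \<or> is_direct_sum ?N U V"
    and U: "U \<noteq> {0}" "lie_semisimple (?N\<lparr>lie_carrier := U\<rparr>)"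
    and V: "V \<noteq> {0}" "lie_solvable (?N\<lparr>lie_carrier := V\<rparr>)"
    using levi unfolding levi_decomposable_def by blast
  have UN: "lie_subalgebra U ?N" and VN: "lie_ideal V ?N" and int: "U \<inter> V = {0}"
    using UV lie_ideal_imp_subalgebra[of U ?N] unfolding is_semidirect_sum_def is_direct_sum_def
    by blast+
  have UG: "lie_subalgebra U G" using UN N by (auto simp: lie_subalgebra_def)
  have "V \<subseteq> N" using VN by (auto simp: lie_ideal_def)
  moreover obtain v where "v \<in> V" "v \<notin> U" using V(1) int by blast
  moreover have "U \<subseteq> N" using UN by (simp add: lie_subalgebra_def)
  ultimately have "U \<subset> N" by blast
  moreover have "K = {0}"
    if K: "lie_ideal K (G\<lparr>lie_carrier := U\<rparr>)" "two_step_solvable G K" for K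
  proof -
    have "lie_subalgebra K G"
      using lie_ideal_imp_subalgebra[OF K(1)] UG by (auto simp: lie_subalgebra_def)
    from lie_solvable_two_step[OF G this] K(2)
    have "lie_solvable (G\<lparr>lie_carrier := K\<rparr>)" by (simp add: two_step_solvable_def)
    then show ?thesis using U(2) K(1) by (simp add: lie_semisimple_def)
  qed
  ultimately have pair: "levi_pair G U N" using UG N U(1) by (simp add: levi_pair_def)
  obtain W where "lie_ideal W ?N" "W \<subseteq> V" "W \<noteq> {0}"
    "\<And>a b. a \<in> W \<Longrightarrow> b \<in> W \<Longrightarrow> lie_bracket ?N a b = 0"
    using solvable_ideal_has_abelian_ideal[OF GN VN V] by metis
  then show ?thesis using that[OF pair] by simp
qed

text \<open>A two-step solvable ideal of the image is the image of its preimage in \<open>U\<close>,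
  which is again such an ideal. The homomorphisms in view are conjugations and
  \<open>neg_transpose\<close>.\<close>

lemma levi_pair_image:
  assumes G: "lie_algebra G" and H: "lie_algebra H" and f: "lie_hom f G H"
    and inj: "inj_on f (lie_carrier G)" and pair: "levi_pair G U N"
  shows "levi_pair H (f ` U) (f ` N)"
proof -
  have N: "lie_subalgebra N G" and U: "lie_subalgebra U G" and UN: "U \<subset> N" and U0: "U \<noteq> {0}"
    and ss: "\<And>K. lie_ideal K (G\<lparr>lie_carrier := U\<rparr>) \<Longrightarrow> two_step_solvable G K \<Longrightarrow> K = {0}"
    using pair by (auto simp: levi_pair_def)
  note UD = lie_subalgebraD[OF G U] and ND = lie_subalgebraD[OF G N] and fD = lie_homD[OF f]
  have f0: "f 0 = 0" using lie_hom_0[OF G f] .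
  have carr: "\<And>a. a \<in> U \<Longrightarrow> a \<in> lie_carrier G" using UD(1) by blast
  have inj': "\<And>a b. a \<in> U \<Longrightarrow> b \<in> U \<Longrightarrow> f a = f b \<Longrightarrow> a = b"
    using inj carr by (auto dest: inj_onD)
  have "f ` U \<subset> f ` N" using UN inj_on_image_eq_iff[OF inj, of U N] UD(1) ND(1) by blast
  moreover have "f ` U \<noteq> {0}"
  proof -
    obtain u where "u \<in> U" "u \<noteq> 0" using U0 UD(2) by blast
    then have "f u \<noteq> 0" using inj'[of u 0] f0 UD(2) by auto
    then show ?thesis using \<open>u \<in> U\<close> by blast
  qed
  moreover have "K = {0}"
    if K: "lie_ideal K (H\<lparr>lie_carrier := f ` U\<rparr>)" "two_step_solvable H K" for K
  proof -
    interpret vs: vector_space "lie_scale G" by (rule lie_algebraD(1)[OF G])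
    interpret vsH: vector_space "lie_scale H" by (rule lie_algebraD(1)[OF H])
    have KU: "K \<subseteq> f ` U" and Ksub: "vsH.subspace K"
      and Kid: "\<And>a b. a \<in> U \<Longrightarrow> b \<in> K \<Longrightarrow> lie_bracket H (f a) b \<in> K"
      using K(1) by (auto simp: lie_ideal_def)
    define L where "L = {a\<in>U. f a \<in> K}"
    have "lie_ideal L (G\<lparr>lie_carrier := U\<rparr>)"
      unfolding lie_ideal_def
    proof (intro conjI ballI)
      show "module.subspace (lie_scale (G\<lparr>lie_carrier := U\<rparr>)) L"
        using UD vsH.subspace_0[OF Ksub] vsH.subspace_add[OF Ksub] vsH.subspace_scale[OF Ksub]
        by (auto simp: L_def f0 fD carr intro!: vs.subspaceI)
    qed (use UD Kid in \<open>auto simp: L_def fD carr\<close>)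
    moreover have "two_step_solvable G L"
      unfolding two_step_solvable_def
    proof (intro ballI)
      fix a b c d assume abcd: "a \<in> L" "b \<in> L" "c \<in> L" "d \<in> L"
      have "f (lie_bracket G (lie_bracket G a b) (lie_bracket G c d)) = 0"
        using abcd K(2) UD(5) by (simp add: L_def fD carr two_step_solvable_def)
      then show "lie_bracket G (lie_bracket G a b) (lie_bracket G c d) = 0"
        using inj'[of _ 0] f0 abcd UD by (simp add: L_def)
    qed
    ultimately have "L = {0}" by (rule ss)
    moreover have "K = f ` L" using KU by (auto simp: L_def)
    ultimately show ?thesis by (simp add: f0)
  qed
  ultimately show ?thesis
    using lie_subalgebra_image[OF G H f N] lie_subalgebra_image[OF G H f U]
    by (simp add: levi_pair_def)
qed

text \<open>The natural maps run from an external sum into the matrices, against the direction of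
  \<open>lie_isomorphic\<close>. Closure of \<open>H\<close> is what carries the homomorphism
  property over to the inverse.\<close>

lemma lie_isomorphic_via_inverse:
  assumes f: "lie_hom f H G" and bij: "bij_betw f (lie_carrier H) (lie_carrier G)"
    and add: "\<And>a b. a \<in> lie_carrier H \<Longrightarrow> b \<in> lie_carrier H \<Longrightarrow> a + b \<in> lie_carrier H"
    and scale: "\<And>k a. a \<in> lie_carrier H \<Longrightarrow> lie_scale H k a \<in> lie_carrier H"
    and bracket: "\<And>a b. a \<in> lie_carrier H \<Longrightarrow> b \<in> lie_carrier H \<Longrightarrow>
      lie_bracket H a b \<in> lie_carrier H"
  shows "lie_isomorphic G H"
proof -
  define g where "g = inv_into (lie_carrier H) f"
  have g: "bij_betw g (lie_carrier G) (lie_carrier H)"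
    unfolding g_def by (rule bij_betw_inv_into[OF bij])
  have fg: "f (g a) = a" if "a \<in> lie_carrier G" for a
    using bij that unfolding g_def by (metis bij_betw_imp_surj_on f_inv_into_f)
  have gf: "g (f a) = a" if "a \<in> lie_carrier H" for a
    using bij that unfolding g_def by (metis bij_betw_imp_inj_on inv_into_f_f)
  have gin: "g a \<in> lie_carrier H" if "a \<in> lie_carrier G" for a
    using g that by (metis bij_betwE)
  note fD = lie_homD[OF f]
  have "lie_hom g G H"
    unfolding lie_hom_def
  proof (intro conjI ballI allI)
    show "g ` lie_carrier G \<subseteq> lie_carrier H" using gin by blast
    fix a assume a: "a \<in> lie_carrier G"
    show "g (lie_scale G k a) = lie_scale H k (g a)" for k
      using gf[OF scale[OF gin[OF a]], of k] fD(3)[OF gin[OF a], of k] fg[OF a] by simp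
    fix b assume b: "b \<in> lie_carrier G"
    show "g (a + b) = g a + g b"
      using gf[OF add[OF gin[OF a] gin[OF b]]] fD(2)[OF gin[OF a] gin[OF b]] fg a b by simp
    show "g (lie_bracket G a b) = lie_bracket H (g a) (g b)"
      using gf[OF bracket[OF gin[OF a] gin[OF b]]] fD(4)[OF gin[OF a] gin[OF b]] fg a b by simp
  qed
  then show ?thesis using g by (auto simp: lie_isomorphic_def)
qed

section \<open>Matrices\<close>

interpretation mspace: vector_space "mscale :: complex \<Rightarrow> complex^'n^'n \<Rightarrow> complex^'n^'n"
  by (rule vector_space_mscale)

lemma sl_simps [simp]:
  "lie_carrier sl_lie = {A. trace A = 0}" "lie_scale sl_lie = mscale"
  "lie_bracket sl_lie A B = A ** B - B ** A"
  by (simp_all add: sl_lie_def)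

text \<open>\<open>Q\<close> stands for the inverse of \<open>P\<close>. As an argument of its own
  it keeps the entries polynomial; \<open>inner_equivalent_iff\<close> makes the link to
  \<open>matrix_inv\<close>.\<close>

definition conj_by :: "complex^3^3 \<Rightarrow> complex^3^3 \<Rightarrow> complex^3^3 \<Rightarrow> complex^3^3" where
  "conj_by P Q A = P ** A ** Q"

definition neg_transpose :: "complex^3^3 \<Rightarrow> complex^3^3" where
  "neg_transpose A = - transpose A"

lemma matrix_inv_eqI:
  fixes P :: "complex^'n^'n"
  assumes "P ** Q = mat 1"
  shows "matrix_inv P = Q"
proof -
  have QP: "Q ** P = mat 1" using assms by (rule matrix_left_right_inverse[THEN iffD1])
  then have "P ** matrix_inv P = mat 1 \<and> matrix_inv P ** P = mat 1"
    unfolding matrix_inv_def using assms by (metis (mono_tags, lifting) someI_ex)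
  then show ?thesis using QP by (metis matrix_mul_assoc matrix_mul_lid matrix_mul_rid)
qed

lemma inner_equivalent_iff:
  "inner_equivalent M N \<longleftrightarrow> (\<exists>P Q. det P = 1 \<and> P ** Q = mat 1 \<and> conj_by P Q ` M = N)"
proof
  assume "inner_equivalent M N"
  then obtain P :: "complex^3^3" where P: "det P = 1" "(\<lambda>A. P ** A ** matrix_inv P) ` M = N"
    by (auto simp: inner_equivalent_def inner_automorphism_def)
  then have "invertible P" by (simp add: invertible_det_nz)
  then obtain Q where "P ** Q = mat 1" by (auto simp: invertible_def)
  then show "\<exists>P Q. det P = 1 \<and> P ** Q = mat 1 \<and> conj_by P Q ` M = N"
    using P matrix_inv_eqI[of P Q] by (auto simp: conj_by_def[abs_def])
next
  assume "\<exists>P Q. det P = 1 \<and> P ** Q = mat 1 \<and> conj_by P Q ` M = N"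
  then obtain P Q where P: "det P = 1" "P ** Q = mat 1" "conj_by P Q ` M = N" by blast
  then show "inner_equivalent M N"
    using matrix_inv_eqI[of P Q]
    by (auto simp: inner_equivalent_def inner_automorphism_def conj_by_def[abs_def])
qed

lemma inner_equivalent_trans:
  assumes "inner_equivalent L M" "inner_equivalent M N"
  shows "inner_equivalent L N"
proof -
  obtain P Q P' Q' where P: "det P = 1" "P ** Q = mat 1" "conj_by P Q ` L = M"
    and P': "det P' = 1" "P' ** Q' = mat 1" "conj_by P' Q' ` M = N"
    using assms unfolding inner_equivalent_iff by blast
  have "(P' ** P) ** (Q ** Q') = P' ** (P ** Q) ** Q'" by (simp only: matrix_mul_assoc)
  then have "(P' ** P) ** (Q ** Q') = mat 1" using P P' by simp
  moreover have "conj_by (P' ** P) (Q ** Q') = conj_by P' Q' \<circ> conj_by P Q"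
    by (auto simp: conj_by_def matrix_mul_assoc)
  then have "conj_by (P' ** P) (Q ** Q') ` L = N" using P P' by (metis image_comp)
  moreover have "det (P' ** P) = 1" using P P' by (simp add: det_mul)
  ultimately show ?thesis unfolding inner_equivalent_iff by blast
qed

lemma neg_transpose_involutive [simp]: "neg_transpose (neg_transpose A) = A"
  by (simp add: neg_transpose_def transpose_def vec_eq_iff)

text \<open>The negative transpose of \<open>P A Q\<close> is \<open>transpose Q\<close> times that
  of \<open>A\<close> times \<open>transpose P\<close>, again a conjugation.\<close>

lemma inner_equivalent_neg_transpose:
  assumes "inner_equivalent M N"
  shows "inner_equivalent (neg_transpose ` M) (neg_transpose ` N)"
proof -
  obtain P Q where P: "det P = 1" "P ** Q = mat 1" "conj_by P Q ` M = N"
    using assms unfolding inner_equivalent_iff by blast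
  have "det Q = 1" using P by (metis det_I det_mul mult_1)
  moreover have "transpose Q ** transpose P = mat 1"
    using P by (metis matrix_transpose_mul transpose_mat)
  moreover have "conj_by (transpose Q) (transpose P) (neg_transpose A) = neg_transpose (conj_by P Q A)"
    for A
    by (simp add: conj_by_def neg_transpose_def coords_3 algebra_simps)
  then have "conj_by (transpose Q) (transpose P) ` (neg_transpose ` M) = neg_transpose ` N"
    using P(3) by (auto simp: image_image)
  ultimately show ?thesis unfolding inner_equivalent_iff by (metis det_transpose)
qed

lemma lie_hom_conj_by:
  assumes "P ** Q = mat 1"
  shows "lie_hom (conj_by P Q) A\<^sub>2 A\<^sub>2" "inj (conj_by P Q)"
proof -
  have QP: "Q ** P = mat 1" using assms by (rule matrix_left_right_inverse[THEN iffD1])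
  have tr: "trace (conj_by P Q A) = trace A" for A
    unfolding conj_by_def by (metis QP matrix_mul_assoc matrix_mul_lid trace_mul_sym)
  have "conj_by P Q (A + B) = conj_by P Q A + conj_by P Q B" for A B
    by (simp add: conj_by_def coords_3 algebra_simps)
  moreover have "conj_by P Q (mscale k A) = mscale k (conj_by P Q A)" for k A
    by (simp add: conj_by_def coords_3 algebra_simps)
  moreover have mult: "conj_by P Q (A ** B) = conj_by P Q A ** conj_by P Q B" for A B
    unfolding conj_by_def by (metis QP matrix_mul_assoc matrix_mul_lid)
  moreover have "conj_by P Q (A - B) = conj_by P Q A - conj_by P Q B" for A B
    by (simp add: conj_by_def coords_3 algebra_simps)
  ultimately show "lie_hom (conj_by P Q) A\<^sub>2 A\<^sub>2"
    by (auto simp: lie_hom_def tr)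
  have "conj_by Q P (conj_by P Q A) = A" for A
    unfolding conj_by_def by (metis QP matrix_mul_assoc matrix_mul_lid matrix_mul_rid)
  then show "inj (conj_by P Q)" by (metis injI)
qed

lemma lie_hom_neg_transpose: "lie_hom neg_transpose A\<^sub>2 A\<^sub>2" "inj neg_transpose"
proof -
  show "lie_hom neg_transpose A\<^sub>2 A\<^sub>2"
    by (auto simp: lie_hom_def neg_transpose_def coords_3 algebra_simps eq_neg_iff_add_eq_0
        neg_eq_iff_add_eq_0)
  show "inj neg_transpose" by (metis injI neg_transpose_involutive)
qed

section \<open>The five subalgebras\<close>

text \<open>The block consists of rows and columns 1 and 3, because \<open>x\<^sub>3\<close> and
  \<open>y\<^sub>3\<close> occupy the corners. The prefixes \<open>column\<close> and
  \<open>row\<close> tell whether the rest of the second column or of the second row is free.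
  Conditions on entries make membership a matter of computation.\<close>

definition block_sl :: "(complex^3^3) set" where
  "block_sl = {A. A$1$2 = 0 \<and> A$3$2 = 0 \<and> A$2$1 = 0 \<and> A$2$3 = 0 \<and> A$2$2 = 0 \<and> A$1$1 + A$3$3 = 0}"

definition block_gl :: "(complex^3^3) set" where
  "block_gl = {A. A$1$2 = 0 \<and> A$3$2 = 0 \<and> A$2$1 = 0 \<and> A$2$3 = 0 \<and> A$1$1 + A$2$2 + A$3$3 = 0}"

definition column_sl :: "(complex^3^3) set" where
  "column_sl = {A. A$2$1 = 0 \<and> A$2$3 = 0 \<and> A$2$2 = 0 \<and> A$1$1 + A$3$3 = 0}"

definition row_sl :: "(complex^3^3) set" where
  "row_sl = {A. A$1$2 = 0 \<and> A$3$2 = 0 \<and> A$2$2 = 0 \<and> A$1$1 + A$3$3 = 0}"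

definition column_parabolic :: "(complex^3^3) set" where
  "column_parabolic = {A. A$2$1 = 0 \<and> A$2$3 = 0 \<and> A$1$1 + A$2$2 + A$3$3 = 0}"

definition row_parabolic :: "(complex^3^3) set" where
  "row_parabolic = {A. A$1$2 = 0 \<and> A$3$2 = 0 \<and> A$1$1 + A$2$2 + A$3$3 = 0}"

lemmas chevalley_defs = h\<^sub>1_def h\<^sub>2_def x\<^sub>1_def x\<^sub>2_def x\<^sub>3_def y\<^sub>1_def y\<^sub>2_def y\<^sub>3_def chevalley_matrix_def

lemmas sl3_subalgebraD = lie_subalgebraD[OF lie_algebra_sl[where 'n = 3], simplified]

text \<open>
  The components of an element of \<open>N\<close> along \<open>h\<^sub>1 - h\<^sub>2\<close>, \<open>x\<^sub>1\<close> and \<open>y\<^sub>2\<close> have the weights 0, 1 and -1 for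
  \<open>h\<^sub>1 + h\<^sub>2\<close>, hence lie in \<open>N\<close>; and \<open>x\<^sub>3\<close>, \<open>y\<^sub>3\<close> exchange \<open>x\<^sub>1\<close> and \<open>y\<^sub>2\<close> up to sign.
\<close>

lemma subalgebra_between_block_sl_and_parabolic:
  assumes N: "lie_subalgebra N A\<^sub>2" and lower: "block_sl \<subset> N" and upper: "N \<subseteq> column_parabolic"
  shows "N = block_gl \<or> N = column_sl \<or> N = column_parabolic"
proof -
  note ND = sl3_subalgebraD[OF N]
  have diff: "A - B \<in> N" if "A \<in> N" "B \<in> N" for A B
    using mspace.subspace_diff[of N A B] N that by (simp add: lie_subalgebra_def)
  define D C where "D = h\<^sub>1 - h\<^sub>2" and "C a b = mscale a x\<^sub>1 + mscale b y\<^sub>2" for a b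
  \<comment> \<open>The projection to \<open>block_sl\<close>. The signs come from the entries -1 of
    \<open>x\<^sub>3\<close> and \<open>y\<^sub>3\<close>.\<close>
  define g where "g A = mscale ((A$1$1 - A$3$3) / 2) (h\<^sub>1 + h\<^sub>2) - mscale (A$1$3) x\<^sub>3 - mscale (A$3$1) y\<^sub>3"
    for A :: "complex^3^3"
  have "g A \<in> block_sl" for A
    by (simp add: g_def block_sl_def chevalley_defs mscale_def)
  then have gN: "g A \<in> N" for A using lower by blast
  \<comment> \<open>\<open>D\<close> is diag(1, -2, 1), so its coefficient is read off at position
    (2, 2).\<close>
  have decomp: "A = g A + mscale (- A$2$2 / 2) D + C (A$1$2) (A$3$2)" if "A \<in> column_parabolic" for A
  proof -
    have "A$2$1 = 0" "A$2$3 = 0" "A$3$3 = - A$1$1 - A$2$2"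
      using that by (simp_all add: column_parabolic_def eq_neg_iff_add_eq_0 algebra_simps)
    then show ?thesis
      by (simp add: vec_eq_iff forall_3 g_def D_def C_def chevalley_defs mscale_def)
        (simp add: field_simps)
  qed
  have unscale: "A \<in> N" if "mscale k A \<in> N" "k \<noteq> 0" for k A
    using ND(4)[OF that(1), of "inverse k"] that(2) by simp
  have comp: "D \<in> N \<or> A$2$2 = 0" "C 1 0 \<in> N \<and> C 0 1 \<in> N \<or> A$1$2 = 0 \<and> A$3$2 = 0"
    if A: "A \<in> N" for A
  proof -
    define H where "H = h\<^sub>1 + h\<^sub>2"
    define B where "B = mscale (- A$2$2 / 2) D + C (A$1$2) (A$3$2)"
    have "H \<in> block_sl" "x\<^sub>3 \<in> block_sl" "y\<^sub>3 \<in> block_sl"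
      by (simp_all add: H_def block_sl_def chevalley_defs)
    then have HN: "H \<in> N" and xN: "x\<^sub>3 \<in> N" and yN: "y\<^sub>3 \<in> N" using lower by blast+
    have "B = A - g A" using decomp[of A] A upper unfolding B_def by (auto simp: algebra_simps)
    then have BN: "B \<in> N" using diff[OF A gN] by simp
    \<comment> \<open>One bracket with \<open>H\<close> removes \<open>D\<close> and changes the
      sign of the \<open>y\<^sub>2\<close> component; a second one restores the sign. The sum and
      the difference of the two results isolate the components.\<close>
    have B1: "H ** B - B ** H = C (A$1$2) (- A$3$2)"
      by (simp add: H_def B_def C_def D_def chevalley_defs coords_3)
    have B2: "H ** C (A$1$2) (- A$3$2) - C (A$1$2) (- A$3$2) ** H = C (A$1$2) (A$3$2)"
      by (simp add: H_def C_def chevalley_defs coords_3)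
    have C1: "C (A$1$2) (- A$3$2) \<in> N" using ND(5)[OF HN BN] by (simp add: B1)
    have C2: "C (A$1$2) (A$3$2) \<in> N" using ND(5)[OF HN C1] by (simp add: B2)
    have "mscale (- A$2$2 / 2) D \<in> N" using diff[OF BN C2] by (simp add: B_def)
    then show "D \<in> N \<or> A$2$2 = 0" using unscale[of "- A$2$2 / 2" D] by auto
    have "mscale (2 * A$1$2) (C 1 0) = C (A$1$2) (A$3$2) + C (A$1$2) (- A$3$2)"
      "mscale (2 * A$3$2) (C 0 1) = C (A$1$2) (A$3$2) - C (A$1$2) (- A$3$2)"
      by (simp_all add: C_def chevalley_defs coords_3)
    then have "mscale (2 * A$1$2) (C 1 0) \<in> N" "mscale (2 * A$3$2) (C 0 1) \<in> N"
      using ND(3)[OF C2 C1] diff[OF C2 C1] by simp_all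
    then have "A$1$2 \<noteq> 0 \<Longrightarrow> C 1 0 \<in> N" "A$3$2 \<noteq> 0 \<Longrightarrow> C 0 1 \<in> N"
      using unscale by force+
    moreover have "C 1 0 \<in> N \<Longrightarrow> C 0 1 \<in> N"
    proof -
      assume "C 1 0 \<in> N"
      then have "C 1 0 ** y\<^sub>3 - y\<^sub>3 ** C 1 0 \<in> N" using ND(5) yN by blast
      also have "C 1 0 ** y\<^sub>3 - y\<^sub>3 ** C 1 0 = C 0 1" by (simp add: C_def chevalley_defs coords_3)
      finally show ?thesis .
    qed
    moreover have "C 0 1 \<in> N \<Longrightarrow> C 1 0 \<in> N"
    proof -
      assume "C 0 1 \<in> N"
      then have "C 0 1 ** x\<^sub>3 - x\<^sub>3 ** C 0 1 \<in> N" using ND(5) xN by blast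
      also have "C 0 1 ** x\<^sub>3 - x\<^sub>3 ** C 0 1 = C 1 0" by (simp add: C_def chevalley_defs coords_3)
      finally show ?thesis .
    qed
    ultimately show "C 1 0 \<in> N \<and> C 0 1 \<in> N \<or> A$1$2 = 0 \<and> A$3$2 = 0" by blast
  qed
  have C: "C a b \<in> N" if "C 1 0 \<in> N" "C 0 1 \<in> N" for a b
  proof -
    have "C a b = mscale a (C 1 0) + mscale b (C 0 1)" by (simp add: C_def)
    then show ?thesis using ND(3,4) that by metis
  qed
  have C0: "C 0 0 = 0" by (simp add: C_def)
  have in_N: "A \<in> N" if A: "A \<in> column_parabolic" and "D \<in> N \<or> A$2$2 = 0"
    and "C 1 0 \<in> N \<and> C 0 1 \<in> N \<or> A$1$2 = 0 \<and> A$3$2 = 0" for A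
  proof -
    have "mscale (- A$2$2 / 2) D \<in> N" using that(2) ND(2) ND(4)[of D "- A$2$2 / 2"] by auto
    moreover have "C (A$1$2) (A$3$2) \<in> N" using that(3) C C0 ND(2) by auto
    ultimately show ?thesis using decomp[OF A] gN[of A] ND(3) by metis
  qed
  have N_iff: "A \<in> N \<longleftrightarrow> A \<in> column_parabolic \<and> (D \<in> N \<or> A$2$2 = 0) \<and>
      (C 1 0 \<in> N \<and> C 0 1 \<in> N \<or> A$1$2 = 0 \<and> A$3$2 = 0)" for A
    using in_N comp upper by blast
  \<comment> \<open>\<open>N\<close> is determined by whether it contains \<open>D\<close> and
    whether it contains the pair \<open>x\<^sub>1\<close>, \<open>y\<^sub>2\<close>. If neither,
    \<open>N\<close> would be \<open>block_sl\<close>, against the strict inclusion.\<close>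
  consider "D \<notin> N" "\<not> (C 1 0 \<in> N \<and> C 0 1 \<in> N)" | "D \<in> N" "\<not> (C 1 0 \<in> N \<and> C 0 1 \<in> N)"
    | "D \<notin> N" "C 1 0 \<in> N \<and> C 0 1 \<in> N" | "D \<in> N" "C 1 0 \<in> N \<and> C 0 1 \<in> N" by blast
  then show ?thesis
  proof cases
    case 1
    then have "A \<in> block_sl" if "A \<in> N" for A
      using that N_iff[of A] by (auto simp: column_parabolic_def block_sl_def)
    then show ?thesis using lower by blast
  next
    case 2
    then have "A \<in> N \<longleftrightarrow> A \<in> block_gl" for A
      using N_iff[of A] by (auto simp: column_parabolic_def block_gl_def)
    then show ?thesis by blast
  next
    case 3
    then have "A \<in> N \<longleftrightarrow> A \<in> column_sl" for A
      using N_iff[of A] by (auto simp: column_parabolic_def column_sl_def)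
    then show ?thesis by blast
  next
    case 4
    then have "A \<in> N \<longleftrightarrow> A \<in> column_parabolic" for A using N_iff[of A] by blast
    then show ?thesis by blast
  qed
qed

text \<open>
  The coordinates of the \<open>sl\<^sub>2\<close>-block in the basis \<open>(h\<^sub>1 + h\<^sub>2) / 2, E\<^sub>1\<^sub>3, E\<^sub>3\<^sub>1\<close>, and their determinant.
\<close>

definition block_det :: "complex^3^3 \<Rightarrow> complex^3^3 \<Rightarrow> complex^3^3 \<Rightarrow> complex" where
  "block_det P Q R =
     (P$1$1 - P$3$3) * (Q$1$3 * R$3$1 - Q$3$1 * R$1$3)
     - (Q$1$1 - Q$3$3) * (P$1$3 * R$3$1 - P$3$1 * R$1$3)
     + (R$1$1 - R$3$3) * (P$1$3 * Q$3$1 - P$3$1 * Q$1$3)"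

text \<open>
  In these coordinates the bracket of \<open>sl\<^sub>2\<close> is a cross product up to a fixed linear map, and this is
  the identity \<open>(p \<times> q) \<times> (r \<times> s) = det (p, q, s) r - det (p, q, r) s\<close>.
\<close>

lemma block_double_bracket:
  fixes P Q R S :: "complex^3^3"
  assumes "P \<in> column_parabolic" "Q \<in> column_parabolic" "R \<in> column_parabolic" "S \<in> column_parabolic"
  defines "T \<equiv> (P ** Q - Q ** P) ** (R ** S - S ** R) - (R ** S - S ** R) ** (P ** Q - Q ** P)"
  shows "T$1$1 - T$3$3 = 2 * (block_det P Q R * (S$1$1 - S$3$3) - block_det P Q S * (R$1$1 - R$3$3))"
    and "T$1$3 = 2 * (block_det P Q R * S$1$3 - block_det P Q S * R$1$3)"
    and "T$3$1 = 2 * (block_det P Q R * S$3$1 - block_det P Q S * R$3$1)"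
proof -
  have z: "P$2$1 = 0" "P$2$3 = 0" "Q$2$1 = 0" "Q$2$3 = 0" "R$2$1 = 0" "R$2$3 = 0" "S$2$1 = 0" "S$2$3 = 0"
    using assms by (simp_all add: column_parabolic_def)
  show "T$1$1 - T$3$3 = 2 * (block_det P Q R * (S$1$1 - S$3$3) - block_det P Q S * (R$1$1 - R$3$3))"
    "T$1$3 = 2 * (block_det P Q R * S$1$3 - block_det P Q S * R$1$3)"
    "T$3$1 = 2 * (block_det P Q R * S$3$1 - block_det P Q S * R$3$1)"
    unfolding T_def block_det_def matrix_matrix_mult_def
    by (simp_all add: sum_3 z, algebra+)
qed

text \<open>The projection of \<open>U\<close> to the traceless block is injective, as its kernel
  \<open>R\<close> is a two-step solvable ideal. It is onto, since
  \<open>block_double_bracket\<close> would otherwise make \<open>U\<close> two-step solvable. Lifts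
  of the standard triple then satisfy its relations, which fix every entry up to \<open>p\<close>
  and \<open>q\<close>.\<close>

lemma levi_pair_contains_sl2_triple:
  assumes pair: "levi_pair A\<^sub>2 U N" and upper: "N \<subseteq> column_parabolic"
  obtains p q where "h\<^sub>1 + h\<^sub>2 + mscale p x\<^sub>1 + mscale q y\<^sub>2 \<in> U" "x\<^sub>3 + mscale q x\<^sub>1 \<in> U"
    "y\<^sub>3 - mscale p y\<^sub>2 \<in> U"
proof -
  have U: "lie_subalgebra U A\<^sub>2" and U0: "U \<noteq> {0}" and "U \<subset> N"
    and ss: "\<And>K. lie_ideal K (A\<^sub>2\<lparr>lie_carrier := U\<rparr>) \<Longrightarrow> two_step_solvable A\<^sub>2 K \<Longrightarrow> K = {0}"
    using pair by (auto simp: levi_pair_def)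
  note UD = sl3_subalgebraD[OF U]
  have Up: "\<And>A. A \<in> U \<Longrightarrow> A \<in> column_parabolic" using \<open>U \<subset> N\<close> upper by blast
  have Uz: "A$2$1 = 0" "A$2$3 = 0" "A$2$2 = - A$1$1 - A$3$3" if "A \<in> U" for A
    using Up[OF that] by (auto simp: column_parabolic_def algebra_simps add_eq_0_iff)
  have diff: "A - B \<in> U" if "A \<in> U" "B \<in> U" for A B
    using mspace.subspace_diff[of U A B] U that by (simp add: lie_subalgebra_def)
  define R where "R = {A\<in>U. A$1$1 = A$3$3 \<and> A$1$3 = 0 \<and> A$3$1 = 0}"
  have "R = {0}"
  proof (rule ss)
    show "lie_ideal R (A\<^sub>2\<lparr>lie_carrier := U\<rparr>)"
      unfolding lie_ideal_def
    proof (intro conjI ballI)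
      show "module.subspace (lie_scale (A\<^sub>2\<lparr>lie_carrier := U\<rparr>)) R"
        using UD by (auto simp: R_def mscale_def intro!: mspace.subspaceI)
      fix A B assume "A \<in> lie_carrier (A\<^sub>2\<lparr>lie_carrier := U\<rparr>)" "B \<in> R"
      then have A: "A \<in> U" and B: "B \<in> U" "B$1$1 = B$3$3" "B$1$3 = 0" "B$3$1 = 0"
        by (auto simp: R_def)
      have "A ** B - B ** A \<in> U" using UD(5) A B by simp
      moreover have "(A ** B - B ** A)$1$1 = (A ** B - B ** A)$3$3"
        "(A ** B - B ** A)$1$3 = 0" "(A ** B - B ** A)$3$1 = 0"
        using Uz[OF A] Uz[OF B(1)] B(2-)
        by (simp_all add: matrix_matrix_mult_def sum_3)
      ultimately show "lie_bracket (A\<^sub>2\<lparr>lie_carrier := U\<rparr>) A B \<in> R" by (simp add: R_def)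
    qed (auto simp: R_def)
    have comm: "A ** B - B ** A = mscale (A$1$1 - A$2$2) (C B) - mscale (B$1$1 - B$2$2) (C A)"
      if "A \<in> R" "B \<in> R" and "C = (\<lambda>A. mscale (A$1$2) x\<^sub>1 + mscale (A$3$2) y\<^sub>2)" for A B C
      using that Uz[of A] Uz[of B]
      by (simp add: R_def chevalley_defs coords_3 algebra_simps)
    show "two_step_solvable A\<^sub>2 R"
      unfolding two_step_solvable_def sl_simps
    proof (intro ballI)
      fix A B C D assume "A \<in> R" "B \<in> R" "C \<in> R" "D \<in> R"
      then show "(A ** B - B ** A) ** (C ** D - D ** C) - (C ** D - D ** C) ** (A ** B - B ** A) = 0"
        unfolding comm[OF \<open>A \<in> R\<close> \<open>B \<in> R\<close> refl] comm[OF \<open>C \<in> R\<close> \<open>D \<in> R\<close> refl]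
        by (simp add: chevalley_defs coords_3)
    qed
  qed
  then have zeroI: "A = 0" if "A \<in> U" "A$1$1 = A$3$3" "A$1$3 = 0" "A$3$1 = 0" for A
    using that by (auto simp: R_def)
  have "\<exists>P\<in>U. \<exists>Q\<in>U. \<exists>R\<in>U. block_det P Q R \<noteq> 0"
  proof (rule ccontr)
    assume "\<not> ?thesis"
    then have det0: "\<And>P Q R. \<lbrakk>P \<in> U; Q \<in> U; R \<in> U\<rbrakk> \<Longrightarrow> block_det P Q R = 0" by blast
    have "two_step_solvable A\<^sub>2 U"
      unfolding two_step_solvable_def sl_simps
    proof (intro ballI)
      fix P Q R S assume PQRS: "P \<in> U" "Q \<in> U" "R \<in> U" "S \<in> U"
      let ?T = "(P ** Q - Q ** P) ** (R ** S - S ** R) - (R ** S - S ** R) ** (P ** Q - Q ** P)"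
      have "?T \<in> U" using PQRS UD(5) by simp
      then show "?T = 0"
        by (rule zeroI)
          (use block_double_bracket[OF PQRS[THEN Up]] det0 PQRS in simp_all)
    qed
    moreover have "lie_ideal U (A\<^sub>2\<lparr>lie_carrier := U\<rparr>)"
      using U UD(5) by (simp add: lie_ideal_def lie_subalgebra_def)
    ultimately show False using ss U0 by blast
  qed
  then obtain P Q R' where PQR: "P \<in> U" "Q \<in> U" "R' \<in> U" "block_det P Q R' \<noteq> 0" by blast
  have solve: "\<exists>A\<in>U. A$1$1 - A$3$3 = t \<and> A$1$3 = u \<and> A$3$1 = v" for t u v
  proof -
    \<comment> \<open>Cramer's rule: \<open>e Q R'\<close>, \<open>e R' P\<close> and
      \<open>e P Q\<close> are \<open>block_det\<close> with the coordinates \<open>t\<close>,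
      \<open>u\<close>, \<open>v\<close> put in place of those of \<open>P\<close>, \<open>Q\<close>
      and \<open>R'\<close>.\<close>
    define d where "d = block_det P Q R'"
    define e where "e A B = t * (A$1$3 * B$3$1 - A$3$1 * B$1$3)
      - (A$1$1 - A$3$3) * (u * B$3$1 - v * B$1$3) + (B$1$1 - B$3$3) * (u * A$3$1 - v * A$1$3)"
      for A B :: "complex^3^3"
    define A where "A = mscale (1 / d) (mscale (e Q R') P + mscale (e R' P) Q + mscale (e P Q) R')"
    have "A \<in> U" unfolding A_def by (intro UD PQR)
    moreover have "d \<noteq> 0" using PQR by (simp add: d_def)
    then have "A$1$1 - A$3$3 = t" "A$1$3 = u" "A$3$1 = v"
      by (simp_all add: A_def mscale_def divide_simps e_def d_def block_det_def) algebra+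
    ultimately show ?thesis by blast
  qed
  obtain H where H: "H \<in> U" "H$1$1 - H$3$3 = 2" "H$1$3 = 0" "H$3$1 = 0" using solve by blast
  \<comment> \<open>The values -1 here and for \<open>Y\<close> match the corner entries of
    \<open>x\<^sub>3\<close> and \<open>y\<^sub>3\<close>.\<close>
  obtain X where X: "X \<in> U" "X$1$1 - X$3$3 = 0" "X$1$3 = -1" "X$3$1 = 0" using solve by blast
  obtain Y where Y: "Y \<in> U" "Y$1$1 - Y$3$3 = 0" "Y$1$3 = 0" "Y$3$1 = -1" using solve by blast
  have e33: "H$3$3 = H$1$1 - 2" "X$3$3 = X$1$1" "Y$3$3 = Y$1$1"
    using H(2) X(2) Y(2) by (auto simp: algebra_simps)
  note ent = e33 H(3,4) X(3,4) Y(3,4) Uz(1,2)[OF H(1)] Uz(1,2)[OF X(1)] Uz(1,2)[OF Y(1)]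
  \<comment> \<open>The relation holds in the block by choice of the coordinates, and injectivity of
    the projection lifts it to \<open>U\<close>. The next two relations follow likewise.\<close>
  have XY: "X ** Y - Y ** X - H = 0"
  proof (rule zeroI)
    show "X ** Y - Y ** X - H \<in> U" by (intro diff[OF UD(5)] H(1) X(1) Y(1))
  qed (simp_all add: matrix_matrix_mult_def sum_3 ent)
  have HX: "H ** X - X ** H - mscale 2 X = 0"
  proof (rule zeroI)
    show "H ** X - X ** H - mscale 2 X \<in> U" by (intro diff[OF UD(5)] UD(4) H(1) X(1))
  qed (simp_all add: matrix_matrix_mult_def sum_3 mscale_def ent algebra_simps)
  have HY: "H ** Y - Y ** H - mscale (-2) Y = 0"
  proof (rule zeroI)
    show "H ** Y - Y ** H - mscale (-2) Y \<in> U" by (intro diff[OF UD(5)] UD(4) H(1) Y(1))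
  qed (simp_all add: matrix_matrix_mult_def sum_3 mscale_def ent algebra_simps)
  \<comment> \<open>Position (2, 2) of the relations forces zero there in all three matrices;
    positions (1, 2) and (3, 2) reduce the second columns to the two entries of
    \<open>H\<close>.\<close>
  have c: "(X ** Y - Y ** X - H)$2$2 = 0" "(H ** X - X ** H - mscale 2 X)$2$2 = 0"
    "(H ** Y - Y ** H - mscale (-2) Y)$2$2 = 0"
    "(H ** X - X ** H - mscale 2 X)$1$2 = 0" "(H ** X - X ** H - mscale 2 X)$3$2 = 0"
    "(H ** Y - Y ** H - mscale (-2) Y)$1$2 = 0" "(H ** Y - Y ** H - mscale (-2) Y)$3$2 = 0"
    unfolding XY HX HY by simp_all
  have d2: "X$2$2 = 0" "Y$2$2 = 0" "H$2$2 = 0"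
    using c(1-3) by (simp_all add: matrix_matrix_mult_def sum_3 mscale_def ent)
  have d1: "X$1$1 = 0" "Y$1$1 = 0" "H$1$1 = 1"
    using Uz(3)[OF H(1)] Uz(3)[OF X(1)] Uz(3)[OF Y(1)] d2 e33 by auto
  have o: "X$1$2 = H$3$2" "X$3$2 = 0" "Y$1$2 = 0" "Y$3$2 = - H$1$2"
    using c(4-7) by (auto simp: matrix_matrix_mult_def sum_3 mscale_def ent d1 d2 algebra_simps
        eq_neg_iff_add_eq_0 neg_eq_iff_add_eq_0)
  have eqs: "h\<^sub>1 + h\<^sub>2 + mscale (H$1$2) x\<^sub>1 + mscale (H$3$2) y\<^sub>2 = H"
      "x\<^sub>3 + mscale (H$3$2) x\<^sub>1 = X" "y\<^sub>3 - mscale (H$1$2) y\<^sub>2 = Y"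
    by (simp_all add: vec_eq_iff forall_3 chevalley_defs mscale_def ent d1 d2 o)
  show ?thesis
    using that[of "H$1$2" "H$3$2", unfolded eqs, OF H(1) X(1) Y(1)] .
qed

text \<open>The conjugating matrix \<open>S\<close> moves the kernel of the semisimple element of the triple to \<open>e\<^sub>2\<close>.\<close>

lemma levi_pair_in_column_parabolic:
  assumes pair: "levi_pair A\<^sub>2 U N" and upper: "N \<subseteq> column_parabolic"
  shows "\<exists>M\<in>{block_gl, column_sl, column_parabolic}. inner_equivalent N M"
proof -
  have N: "lie_subalgebra N A\<^sub>2" and U: "lie_subalgebra U A\<^sub>2" and UN: "U \<subset> N"
    using pair by (auto simp: levi_pair_def)
  note UD = sl3_subalgebraD[OF U]
  obtain p q where pq: "h\<^sub>1 + h\<^sub>2 + mscale p x\<^sub>1 + mscale q y\<^sub>2 \<in> U" "x\<^sub>3 + mscale q x\<^sub>1 \<in> U"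
      "y\<^sub>3 - mscale p y\<^sub>2 \<in> U"
    using levi_pair_contains_sl2_triple[OF assms] .
  \<comment> \<open>On \<open>block_sl\<close> this inverts the projection of \<open>U\<close> to
    its block; conjugation by \<open>S\<close> will carry \<open>F A\<close> back to
    \<open>A\<close>.\<close>
  define F where "F A = mscale (A$1$1) (h\<^sub>1 + h\<^sub>2 + mscale p x\<^sub>1 + mscale q y\<^sub>2)
       - mscale (A$1$3) (x\<^sub>3 + mscale q x\<^sub>1) - mscale (A$3$1) (y\<^sub>3 - mscale p y\<^sub>2)"
    for A :: "complex^3^3"
  have diff: "A - B \<in> U" if "A \<in> U" "B \<in> U" for A B
    using mspace.subspace_diff[of U A B] U that by (simp add: lie_subalgebra_def)
  have FU: "F A \<in> U" for A
    unfolding F_def by (intro diff UD(4) pq)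
  define S S' :: "complex^3^3" where
    "S = vector [vector [1, p, 0], vector [0, 1, 0], vector [0, - q, 1]]" and
    "S' = vector [vector [1, - p, 0], vector [0, 1, 0], vector [0, q, 1]]"
  have SS: "S ** S' = mat 1" by (simp add: S_def S'_def coords_3)
  have det: "det S = 1" by (simp add: S_def det_3)
  note hom = lie_hom_conj_by[OF SS]
  define M where "M = conj_by S S' ` N"
  have eq: "inner_equivalent N M" using SS det unfolding inner_equivalent_iff M_def by blast
  have M: "lie_subalgebra M A\<^sub>2"
    unfolding M_def by (rule lie_subalgebra_image[OF lie_algebra_sl lie_algebra_sl hom(1) N])
  have conjF: "conj_by S S' (F A) = A" if "A \<in> block_sl" for A
    using that
    by (simp add: conj_by_def F_def S_def S'_def block_sl_def chevalley_defs coords_3 algebra_simps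
        eq_neg_iff_add_eq_0 neg_eq_iff_add_eq_0)
  have "block_sl \<subseteq> conj_by S S' ` U" using conjF FU by (metis image_eqI subsetI)
  moreover have "conj_by S S' ` U \<subset> M"
    unfolding M_def using UN inj_image_eq_iff[OF hom(2), of U N] by blast
  ultimately have "block_sl \<subset> M" by blast
  moreover have "M \<subseteq> column_parabolic"
  proof
    fix B assume "B \<in> M"
    then obtain A where A: "A \<in> N" "B = conj_by S S' A" by (auto simp: M_def)
    have "trace B = 0" using M \<open>B \<in> M\<close> by (auto simp: lie_subalgebra_def)
    moreover have "A$2$1 = 0" "A$2$3 = 0" using A upper by (auto simp: column_parabolic_def)
    then have "B$2$1 = 0" "B$2$3 = 0"
      unfolding A(2) by (simp_all add: conj_by_def S_def S'_def matrix_matrix_mult_def sum_3)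
    ultimately show "B \<in> column_parabolic" by (simp add: column_parabolic_def trace_def sum_3)
  qed
  ultimately show ?thesis
    using subalgebra_between_block_sl_and_parabolic[OF M] eq by blast
qed

section \<open>Moving a stable plane or line into standard position\<close>

text \<open>Conjugation by such a \<open>P\<close> turns the form \<open>w\<close> into the second
  coordinate, which vanishes on the plane of the first and third basis vectors.\<close>

lemma unimodular_second_row:
  fixes w :: "complex^3"
  assumes "w \<noteq> 0"
  obtains P :: "complex^3^3" where "det P = 1" "P$2 = w"
proof -
  consider "w$1 \<noteq> 0" | "w$2 \<noteq> 0" | "w$3 \<noteq> 0" using assms by (auto simp: vec_eq_iff forall_3)
  then show ?thesis
  proof cases
    case 1
    then show ?thesis
      by (intro that[of "vector [vector [0, - 1 / w$1, 0], w, vector [0, 0, 1]]"])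
        (simp_all add: det_3)
  next
    case 2
    then show ?thesis
      by (intro that[of "vector [vector [1 / w$2, 0, 0], w, vector [0, 0, 1]]"])
        (simp_all add: det_3)
  next
    case 3
    then show ?thesis
      by (intro that[of "vector [vector [1, 0, 0], w, vector [0, - 1 / w$3, 0]]"])
        (simp_all add: det_3)
  qed
qed

lemma levi_pair_stable_plane:
  assumes pair: "levi_pair A\<^sub>2 U N" and plane: "stable_plane N"
  shows "\<exists>M\<in>{block_gl, column_sl, column_parabolic}. inner_equivalent N M"
proof -
  obtain w where w: "w \<noteq> 0" "\<And>A. A \<in> N \<Longrightarrow> \<exists>c. w v* A = c *s w"
    using plane by (auto simp: stable_plane_def)
  obtain P where P: "det P = 1" "P$2 = w" using unimodular_second_row[OF w(1)] .
  then have "invertible P" by (simp add: invertible_det_nz)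
  then obtain Q where PQ: "P ** Q = mat 1" by (auto simp: invertible_def)
  note hom = lie_hom_conj_by[OF PQ]
  define M where "M = conj_by P Q ` N"
  have pairM: "levi_pair A\<^sub>2 (conj_by P Q ` U) M"
    unfolding M_def
    by (rule levi_pair_image[OF lie_algebra_sl lie_algebra_sl hom(1) inj_on_subset[OF hom(2)] pair]) simp
  have eq: "inner_equivalent N M" using PQ P unfolding inner_equivalent_iff M_def by blast
  have "M \<subseteq> column_parabolic"
  proof
    fix B assume "B \<in> M"
    then obtain A where A: "A \<in> N" "B = P ** A ** Q" by (auto simp: M_def conj_by_def)
    obtain c where c: "w v* A = c *s w" using w(2)[OF A(1)] by blast
    have row: "(X ** Y)$i = X$i v* Y" for X Y :: "complex^3^3" and i
      by (simp add: matrix_matrix_mult_def vector_matrix_mult_def vec_eq_iff mult.commute)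
    \<comment> \<open>As \<open>w\<close> is the second row of \<open>P\<close>,
      \<open>w v* Q\<close> is the second row of the identity; so the second row of \<open>B\<close>
      is \<open>c\<close> times a basis vector.\<close>
    have "B$2 = (c *s w) v* Q" by (simp add: A(2) row P(2) c)
    also have "\<dots> = c *s (w v* Q)"
      by (simp add: vector_matrix_mult_def vec_eq_iff sum_distrib_left algebra_simps)
    also have "w v* Q = (mat 1 :: complex^3^3)$2" using row[of P Q 2] by (simp add: P(2) PQ)
    finally have "B$2$1 = 0" "B$2$3 = 0" by (simp_all add: mat_def)
    moreover have "trace B = 0"
      using pairM \<open>B \<in> M\<close> by (auto simp: levi_pair_def lie_subalgebra_def)
    ultimately show "B \<in> column_parabolic" by (simp add: column_parabolic_def trace_def sum_3)
  qed
  then show ?thesis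
    using levi_pair_in_column_parabolic[OF pairM] inner_equivalent_trans[OF eq] by blast
qed

lemma neg_transpose_images:
  "neg_transpose ` block_gl = block_gl" "neg_transpose ` column_sl = row_sl"
  "neg_transpose ` column_parabolic = row_parabolic"
proof -
  have image: "neg_transpose ` S = T"
    if "\<And>A. A \<in> S \<Longrightarrow> neg_transpose A \<in> T" "\<And>A. A \<in> T \<Longrightarrow> neg_transpose A \<in> S" for S T
    using that by (metis image_subsetI neg_transpose_involutive image_eqI subsetI subset_antisym)
  show "neg_transpose ` block_gl = block_gl" "neg_transpose ` column_sl = row_sl"
    "neg_transpose ` column_parabolic = row_parabolic"
    by (rule image; simp add: neg_transpose_def transpose_def block_gl_def column_sl_def row_sl_def
      column_parabolic_def row_parabolic_def; algebra)+
qed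

text \<open>Multiplying a row \<open>v\<close> by the negative transpose of \<open>A\<close> gives
  the negative of \<open>A *v v\<close>, so invariant forms and eigenvectors change places.\<close>

lemma stable_plane_neg_transpose: "stable_plane (neg_transpose ` N) \<longleftrightarrow> stable_line N"
proof -
  have "v v* neg_transpose A = - (A *v v)" for A v
    by (simp add: neg_transpose_def coords_3 algebra_simps)
  moreover have "- u = c *s v \<longleftrightarrow> u = (- c) *s v" for u v :: "complex^3" and c
    by (metis minus_minus vec.scale_minus_left)
  ultimately have "(\<exists>c. v v* neg_transpose A = c *s v) \<longleftrightarrow> (\<exists>c. A *v v = c *s v)" for A v
    by (metis minus_minus)
  then show ?thesis by (simp add: stable_plane_def stable_line_def)
qed

text \<open>The plane case is applied to the image under \<open>neg_transpose\<close>, and the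
  involution brings the result back.\<close>

lemma levi_pair_stable_line:
  assumes pair: "levi_pair A\<^sub>2 U N" and line: "stable_line N"
  shows "\<exists>M\<in>{block_gl, row_sl, row_parabolic}. inner_equivalent N M"
proof -
  have "stable_plane (neg_transpose ` N)" using line by (simp add: stable_plane_neg_transpose)
  moreover have "levi_pair A\<^sub>2 (neg_transpose ` U) (neg_transpose ` N)"
    by (rule levi_pair_image[OF lie_algebra_sl lie_algebra_sl lie_hom_neg_transpose(1)
        inj_on_subset[OF lie_hom_neg_transpose(2)] pair]) simp
  ultimately obtain M where M: "M \<in> {block_gl, column_sl, column_parabolic}"
      "inner_equivalent (neg_transpose ` N) M"
    using levi_pair_stable_plane by blast
  have "inner_equivalent N (neg_transpose ` M)"
    using inner_equivalent_neg_transpose[OF M(2)] by (simp add: image_image)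
  then show ?thesis using M(1) neg_transpose_images by auto
qed

lemma levi_decomposable_classification:
  assumes N: "lie_subalgebra N A\<^sub>2" and levi: "levi_decomposable (A\<^sub>2\<lparr>lie_carrier := N\<rparr>)"
  shows "\<exists>M\<in>{block_gl, column_sl, row_sl, column_parabolic, row_parabolic}. inner_equivalent N M"
proof -
  obtain U W where pair: "levi_pair A\<^sub>2 U N" and W: "lie_ideal W (A\<^sub>2\<lparr>lie_carrier := N\<rparr>)" "W \<noteq> {0}"
    and ab: "\<And>A B. A \<in> W \<Longrightarrow> B \<in> W \<Longrightarrow> lie_bracket A\<^sub>2 A B = 0"
    using levi_decomposable_imp_levi_pair[OF lie_algebra_sl N levi] by metis
  have WN: "W \<subseteq> N" and Wsub: "mspace.subspace W"
    and ideal: "\<And>X A. X \<in> N \<Longrightarrow> A \<in> W \<Longrightarrow> X ** A - A ** X \<in> W"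
    using W(1) by (auto simp: lie_ideal_def)
  obtain A0 where "A0 \<in> W" "A0 \<noteq> 0" using W(2) mspace.subspace_0[OF Wsub] by blast
  moreover have "A ** B = B ** A" if "A \<in> W" "B \<in> W" for A B using ab[OF that] by simp
  moreover have "trace A = 0" if "A \<in> W" for A
    using that WN N by (auto simp: lie_subalgebra_def)
  ultimately have "stable_line N \<or> stable_plane N"
    using stable_line_or_plane[OF ideal WN] mspace.subspace_neg[OF Wsub] by blast
  then show ?thesis
    using levi_pair_stable_line[OF pair] levi_pair_stable_plane[OF pair] by blast
qed

section \<open>Invariants separating the five subalgebras\<close>

lemma inner_equivalent_sym:
  assumes "inner_equivalent M N"
  shows "inner_equivalent N M"
proof -
  obtain P Q where P: "det P = 1" "P ** Q = mat 1" "conj_by P Q ` M = N"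
    using assms unfolding inner_equivalent_iff by blast
  have QP: "Q ** P = mat 1" using P(2) by (rule matrix_left_right_inverse[THEN iffD1])
  have "det Q = 1" using P by (metis det_I det_mul mult_1)
  moreover have "conj_by Q P (conj_by P Q A) = A" for A
    unfolding conj_by_def by (metis QP matrix_mul_assoc matrix_mul_lid matrix_mul_rid)
  then have "conj_by Q P ` N = M" using P(3) by (auto simp: image_image)
  ultimately show ?thesis unfolding inner_equivalent_iff using QP by blast
qed

lemma stable_line_inner_equivalent:
  assumes "inner_equivalent M N" "stable_line M"
  shows "stable_line N"
proof -
  obtain P Q where P: "P ** Q = mat 1" "conj_by P Q ` M = N"
    using assms unfolding inner_equivalent_iff by blast
  have QP: "Q ** P = mat 1" using P(1) by (rule matrix_left_right_inverse[THEN iffD1])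
  obtain v where v: "v \<noteq> 0" "\<And>A. A \<in> M \<Longrightarrow> \<exists>c. A *v v = c *s v"
    using assms(2) by (auto simp: stable_line_def)
  have "Q *v (P *v v) = v" by (simp add: matrix_vector_mul_assoc QP)
  then have "P *v v \<noteq> 0" using v(1) by (metis matrix_vector_mult_0_right)
  moreover have "\<exists>c. B *v (P *v v) = c *s (P *v v)" if "B \<in> N" for B
  proof -
    obtain A where A: "A \<in> M" "B = conj_by P Q A" using \<open>B \<in> N\<close> P(2) by blast
    have "B *v (P *v v) = P *v (A *v v)"
      unfolding A(2) conj_by_def
      by (metis QP matrix_mul_assoc matrix_mul_rid matrix_vector_mul_assoc)
    then show ?thesis using v(2)[OF A(1)] by auto
  qed
  ultimately show ?thesis by (auto simp: stable_line_def)
qed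

lemma stable_plane_inner_equivalent:
  assumes "inner_equivalent M N" "stable_plane M"
  shows "stable_plane N"
proof -
  have "stable_line (neg_transpose ` M)"
    using assms(2) stable_plane_neg_transpose[of "neg_transpose ` M"] by (simp add: image_image)
  then have "stable_line (neg_transpose ` N)"
    using stable_line_inner_equivalent inner_equivalent_neg_transpose[OF assms(1)] by blast
  then show ?thesis
    using stable_plane_neg_transpose[of "neg_transpose ` N"] by (simp add: image_image)
qed

text \<open>An easy substitute for comparing dimensions: \<open>h\<^sub>1 - h\<^sub>2\<close> =
  diag(1, -2, 1) is invertible, while \<open>column_sl\<close> and \<open>row_sl\<close> have a zero
  second row or column.\<close>

definition all_singular :: "(complex^3^3) set \<Rightarrow> bool" where
  "all_singular N \<longleftrightarrow> (\<forall>A\<in>N. det A = 0)"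

lemma all_singular_inner_equivalent:
  assumes "inner_equivalent M N" "all_singular M"
  shows "all_singular N"
  using assms unfolding inner_equivalent_iff all_singular_def
  by (auto simp: conj_by_def det_mul)

lemma stable_plane_column_parabolic: "stable_plane column_parabolic"
  unfolding stable_plane_def
proof (intro exI[of _ "axis 2 1"] conjI ballI)
  show "axis 2 1 \<noteq> (0 :: complex^3)" by (simp add: axis_eq_0_iff)
  fix A assume "A \<in> column_parabolic"
  then have "axis 2 1 v* A = (A$2$2) *s axis 2 1"
    by (simp add: coords_3 axis_def column_parabolic_def)
  then show "\<exists>c. axis 2 1 v* A = c *s axis 2 1" by blast
qed

text \<open>A common eigenvector is killed by the nilpotent matrices \<open>x\<^sub>1\<close>,
  \<open>x\<^sub>3\<close> and \<open>y\<^sub>3\<close>, whose kernels meet in zero only.\<close>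

lemma not_stable_line_column_sl: "\<not> stable_line column_sl"
proof
  assume "stable_line column_sl"
  then obtain v where v: "v \<noteq> 0" "\<And>A. A \<in> column_sl \<Longrightarrow> \<exists>c. A *v v = c *s v"
    by (auto simp: stable_line_def)
  have "x\<^sub>1 \<in> column_sl" "x\<^sub>3 \<in> column_sl" "y\<^sub>3 \<in> column_sl"
    by (simp_all add: column_sl_def chevalley_defs)
  then obtain c d e where cde: "x\<^sub>1 *v v = c *s v" "x\<^sub>3 *v v = d *s v" "y\<^sub>3 *v v = e *s v"
    using v(2) by metis
  have "v$2 = 0" using cde(1) by (auto simp: chevalley_defs coords_3)
  moreover have "v$3 = 0" using cde(2) by (auto simp: chevalley_defs coords_3)
  moreover have "v$1 = 0" using cde(3) by (auto simp: chevalley_defs coords_3)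
  ultimately show False using v(1) by (simp add: vec_eq_iff forall_3)
qed

lemma stable_mono:
  "stable_line N \<Longrightarrow> M \<subseteq> N \<Longrightarrow> stable_line M" "stable_plane N \<Longrightarrow> M \<subseteq> N \<Longrightarrow> stable_plane M"
  unfolding stable_line_def stable_plane_def by blast+

lemma invariants_column:
  "stable_plane column_sl" "stable_plane column_parabolic" "stable_plane block_gl"
  "\<not> stable_line column_sl" "\<not> stable_line column_parabolic"
proof -
  have "column_sl \<subseteq> column_parabolic" by (auto simp: column_sl_def column_parabolic_def)
  moreover have "block_gl \<subseteq> column_parabolic" by (auto simp: block_gl_def column_parabolic_def)
  ultimately show "stable_plane column_sl" "stable_plane column_parabolic" "stable_plane block_gl"
    "\<not> stable_line column_sl" "\<not> stable_line column_parabolic"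
    using stable_plane_column_parabolic not_stable_line_column_sl stable_mono by blast+
qed

lemma invariants_row:
  "stable_line row_sl" "stable_line row_parabolic" "stable_line block_gl"
  "\<not> stable_plane row_sl" "\<not> stable_plane row_parabolic"
proof -
  have flip: "stable_line (neg_transpose ` N) \<longleftrightarrow> stable_plane N" for N
    using stable_plane_neg_transpose[of "neg_transpose ` N"] by (simp add: image_image)
  show "stable_line row_sl" "stable_line row_parabolic" "stable_line block_gl"
    "\<not> stable_plane row_sl" "\<not> stable_plane row_parabolic"
    using invariants_column flip stable_plane_neg_transpose neg_transpose_images by metis+
qed

lemma invariants_singular:
  "all_singular column_sl" "all_singular row_sl"
  "\<not> all_singular block_gl" "\<not> all_singular column_parabolic" "\<not> all_singular row_parabolic"
proof -
  show "all_singular column_sl" "all_singular row_sl"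
    by (simp_all add: all_singular_def det_3 column_sl_def row_sl_def)
  have "det (h\<^sub>1 - h\<^sub>2) \<noteq> 0" by (simp add: det_3 chevalley_defs)
  moreover have "h\<^sub>1 - h\<^sub>2 \<in> block_gl" "h\<^sub>1 - h\<^sub>2 \<in> column_parabolic" "h\<^sub>1 - h\<^sub>2 \<in> row_parabolic"
    by (simp_all add: block_gl_def column_parabolic_def row_parabolic_def chevalley_defs)
  ultimately show "\<not> all_singular block_gl" "\<not> all_singular column_parabolic"
    "\<not> all_singular row_parabolic"
    by (auto simp: all_singular_def)
qed

text \<open>Only \<open>block_gl\<close> stabilises both a line and a plane. The
  \<open>column\<close> algebras stabilise just a plane and the \<open>row\<close> algebras just a
  line; within each pair \<open>all_singular\<close> decides.\<close>

lemma inner_equivalent_imp_same_invariants: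
  assumes "inner_equivalent M N"
  shows "stable_line M \<longleftrightarrow> stable_line N" "stable_plane M \<longleftrightarrow> stable_plane N"
    "all_singular M \<longleftrightarrow> all_singular N"
  using assms inner_equivalent_sym[OF assms] stable_line_inner_equivalent
    stable_plane_inner_equivalent all_singular_inner_equivalent by metis+

section \<open>Levi decompositions of the five subalgebras\<close>

text \<open>The factor -2, here and in the two radicals below, is the middle entry of
  \<open>h\<^sub>1 - h\<^sub>2\<close>.\<close>

definition diag_line :: "(complex^3^3) set" where
  "diag_line = {A. A$1$2 = 0 \<and> A$3$2 = 0 \<and> A$2$1 = 0 \<and> A$2$3 = 0 \<and> A$1$3 = 0 \<and> A$3$1 = 0 \<and>
     A$3$3 = A$1$1 \<and> A$2$2 = - 2 * A$1$1}"

definition column_part :: "(complex^3^3) set" where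
  "column_part = {A. A$2$1 = 0 \<and> A$2$3 = 0 \<and> A$1$3 = 0 \<and> A$3$1 = 0 \<and>
     A$1$1 = 0 \<and> A$2$2 = 0 \<and> A$3$3 = 0}"

definition row_part :: "(complex^3^3) set" where
  "row_part = {A. A$1$2 = 0 \<and> A$3$2 = 0 \<and> A$1$3 = 0 \<and> A$3$1 = 0 \<and>
     A$1$1 = 0 \<and> A$2$2 = 0 \<and> A$3$3 = 0}"

definition column_radical :: "(complex^3^3) set" where
  "column_radical = {A. A$2$1 = 0 \<and> A$2$3 = 0 \<and> A$1$3 = 0 \<and> A$3$1 = 0 \<and>
     A$3$3 = A$1$1 \<and> A$2$2 = - 2 * A$1$1}"

definition row_radical :: "(complex^3^3) set" where
  "row_radical = {A. A$1$2 = 0 \<and> A$3$2 = 0 \<and> A$1$3 = 0 \<and> A$3$1 = 0 \<and>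
     A$3$3 = A$1$1 \<and> A$2$2 = - 2 * A$1$1}"

lemmas block_defs = block_sl_def block_gl_def column_sl_def row_sl_def column_parabolic_def
  row_parabolic_def diag_line_def column_part_def row_part_def column_radical_def row_radical_def

lemma lie_subalgebra_blocks:
  "lie_subalgebra block_sl A\<^sub>2" "lie_subalgebra block_gl A\<^sub>2" "lie_subalgebra column_sl A\<^sub>2"
  "lie_subalgebra row_sl A\<^sub>2" "lie_subalgebra column_parabolic A\<^sub>2" "lie_subalgebra row_parabolic A\<^sub>2"
  "lie_subalgebra diag_line A\<^sub>2" "lie_subalgebra column_part A\<^sub>2" "lie_subalgebra row_part A\<^sub>2"
  "lie_subalgebra column_radical A\<^sub>2" "lie_subalgebra row_radical A\<^sub>2"
proof -
  have subalgebraI: "lie_subalgebra K A\<^sub>2"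
    if "\<And>A. A \<in> K \<Longrightarrow> A$1$1 + A$2$2 + A$3$3 = 0" "0 \<in> K"
      "\<And>A B. A \<in> K \<Longrightarrow> B \<in> K \<Longrightarrow> A + B \<in> K" "\<And>k A. A \<in> K \<Longrightarrow> mscale k A \<in> K"
      "\<And>A B. A \<in> K \<Longrightarrow> B \<in> K \<Longrightarrow> A ** B - B ** A \<in> K" for K
    using that by (intro lie_subalgebraI[OF lie_algebra_sl]) (auto simp: trace_def sum_3)
  show "lie_subalgebra block_sl A\<^sub>2" "lie_subalgebra block_gl A\<^sub>2" "lie_subalgebra column_sl A\<^sub>2"
    "lie_subalgebra row_sl A\<^sub>2" "lie_subalgebra column_parabolic A\<^sub>2" "lie_subalgebra row_parabolic A\<^sub>2"
    "lie_subalgebra diag_line A\<^sub>2" "lie_subalgebra column_part A\<^sub>2" "lie_subalgebra row_part A\<^sub>2"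
    "lie_subalgebra column_radical A\<^sub>2" "lie_subalgebra row_radical A\<^sub>2"
    by (rule subalgebraI; simp add: block_defs mscale_def matrix_matrix_mult_def sum_3; algebra)+
qed

text \<open>In every application the listed generators already span a subalgebra linearly.\<close>

lemma lie_generated_eqI:
  assumes "lie_subalgebra K A\<^sub>2" "S \<subseteq> K" and span: "\<And>A. A \<in> K \<Longrightarrow> A \<in> mspace.span S"
  shows "lie_generated A\<^sub>2 S = K"
  unfolding lie_generated_def
proof (rule hull_unique)
  fix T assume "S \<subseteq> T" "lie_subalgebra T A\<^sub>2"
  then show "K \<subseteq> T"
    using span mspace.span_minimal[of S T] by (auto simp: lie_subalgebra_def)
qed (use assms in auto)

lemma lie_generated_blocks:
  "lie_generated A\<^sub>2 {x\<^sub>3, y\<^sub>3, h\<^sub>1 + h\<^sub>2} = block_sl"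
  "lie_generated A\<^sub>2 {h\<^sub>1 - h\<^sub>2} = diag_line"
  "lie_generated A\<^sub>2 {x\<^sub>1, y\<^sub>2} = column_part"
  "lie_generated A\<^sub>2 {x\<^sub>2, y\<^sub>1} = row_part"
  "lie_generated A\<^sub>2 {h\<^sub>1 - h\<^sub>2, x\<^sub>1, y\<^sub>2} = column_radical"
  "lie_generated A\<^sub>2 {h\<^sub>1 - h\<^sub>2, x\<^sub>2, y\<^sub>1} = row_radical"
proof -
  note span = mspace.span_add mspace.span_scale[OF mspace.span_base]
  have coords: "A = mscale (- A$1$3) x\<^sub>3 + mscale (- A$3$1) y\<^sub>3 + mscale (A$1$1) (h\<^sub>1 + h\<^sub>2)"
    if "A \<in> block_sl" for A
    using that by (simp add: block_defs chevalley_defs vec_eq_iff forall_3 mscale_def add_eq_0_iff)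
  show "lie_generated A\<^sub>2 {x\<^sub>3, y\<^sub>3, h\<^sub>1 + h\<^sub>2} = block_sl"
  proof (rule lie_generated_eqI[OF lie_subalgebra_blocks(1)])
    fix A assume "A \<in> block_sl"
    then show "A \<in> mspace.span {x\<^sub>3, y\<^sub>3, h\<^sub>1 + h\<^sub>2}"
      by (subst coords) (assumption | intro span; simp)+
  qed (simp add: block_defs chevalley_defs)
  have coords: "A = mscale (A$1$1) (h\<^sub>1 - h\<^sub>2)" if "A \<in> diag_line" for A
    using that by (simp add: block_defs chevalley_defs vec_eq_iff forall_3 mscale_def)
  show "lie_generated A\<^sub>2 {h\<^sub>1 - h\<^sub>2} = diag_line"
  proof (rule lie_generated_eqI[OF lie_subalgebra_blocks(7)])
    fix A assume "A \<in> diag_line"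
    then show "A \<in> mspace.span {h\<^sub>1 - h\<^sub>2}"
      by (subst coords) (assumption | intro span; simp)+
  qed (simp add: block_defs chevalley_defs)
  have coords: "A = mscale (A$1$2) x\<^sub>1 + mscale (A$3$2) y\<^sub>2" if "A \<in> column_part" for A
    using that by (simp add: block_defs chevalley_defs vec_eq_iff forall_3 mscale_def)
  show "lie_generated A\<^sub>2 {x\<^sub>1, y\<^sub>2} = column_part"
  proof (rule lie_generated_eqI[OF lie_subalgebra_blocks(8)])
    fix A assume "A \<in> column_part"
    then show "A \<in> mspace.span {x\<^sub>1, y\<^sub>2}"
      by (subst coords) (assumption | intro span; simp)+
  qed (simp add: block_defs chevalley_defs)
  have coords: "A = mscale (A$2$3) x\<^sub>2 + mscale (A$2$1) y\<^sub>1" if "A \<in> row_part" for A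
    using that by (simp add: block_defs chevalley_defs vec_eq_iff forall_3 mscale_def)
  show "lie_generated A\<^sub>2 {x\<^sub>2, y\<^sub>1} = row_part"
  proof (rule lie_generated_eqI[OF lie_subalgebra_blocks(9)])
    fix A assume "A \<in> row_part"
    then show "A \<in> mspace.span {x\<^sub>2, y\<^sub>1}"
      by (subst coords) (assumption | intro span; simp)+
  qed (simp add: block_defs chevalley_defs)
  have coords: "A = mscale (A$1$1) (h\<^sub>1 - h\<^sub>2) + mscale (A$1$2) x\<^sub>1 + mscale (A$3$2) y\<^sub>2"
    if "A \<in> column_radical" for A
    using that by (simp add: block_defs chevalley_defs vec_eq_iff forall_3 mscale_def)
  show "lie_generated A\<^sub>2 {h\<^sub>1 - h\<^sub>2, x\<^sub>1, y\<^sub>2} = column_radical"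
  proof (rule lie_generated_eqI[OF lie_subalgebra_blocks(10)])
    fix A assume "A \<in> column_radical"
    then show "A \<in> mspace.span {h\<^sub>1 - h\<^sub>2, x\<^sub>1, y\<^sub>2}"
      by (subst coords) (assumption | intro span; simp)+
  qed (simp add: block_defs chevalley_defs)
  have coords: "A = mscale (A$1$1) (h\<^sub>1 - h\<^sub>2) + mscale (A$2$3) x\<^sub>2 + mscale (A$2$1) y\<^sub>1"
    if "A \<in> row_radical" for A
    using that by (simp add: block_defs chevalley_defs vec_eq_iff forall_3 mscale_def)
  show "lie_generated A\<^sub>2 {h\<^sub>1 - h\<^sub>2, x\<^sub>2, y\<^sub>1} = row_radical"
  proof (rule lie_generated_eqI[OF lie_subalgebra_blocks(11)])
    fix A assume "A \<in> row_radical"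
    then show "A \<in> mspace.span {h\<^sub>1 - h\<^sub>2, x\<^sub>2, y\<^sub>1}"
      by (subst coords) (assumption | intro span; simp)+
  qed (simp add: block_defs chevalley_defs)
qed

text \<open>Half the difference on the diagonal takes the trace out of the block and leaves it to
  the multiple of \<open>h\<^sub>1 - h\<^sub>2\<close>.\<close>

definition block_projection :: "complex^3^3 \<Rightarrow> complex^3^3" where
  "block_projection A = vector [vector [(A$1$1 - A$3$3) / 2, 0, A$1$3], vector [0, 0, 0],
     vector [A$3$1, 0, (A$3$3 - A$1$1) / 2]]"

lemma subspace_sum_block_sl:
  assumes "lie_subalgebra M A\<^sub>2" "block_sl \<subseteq> M" "V \<subseteq> M"
    and "\<And>A. A \<in> M \<Longrightarrow> A - block_projection A \<in> V"
  shows "subspace_sum block_sl V = M"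
proof
  show "subspace_sum block_sl V \<subseteq> M"
    using assms(2,3) sl3_subalgebraD(3)[OF assms(1)] by (auto simp: subspace_sum_def)
  have "block_projection A \<in> block_sl" for A
    by (simp add: block_projection_def block_sl_def flip: add_divide_distrib)
  moreover have "A = block_projection A + (A - block_projection A)" for A by simp
  ultimately show "M \<subseteq> subspace_sum block_sl V"
    using assms(4) unfolding subspace_sum_def by blast
qed

lemma subspace_sum_blocks:
  "subspace_sum block_sl diag_line = block_gl"
  "subspace_sum block_sl column_part = column_sl"
  "subspace_sum block_sl row_part = row_sl"
  "subspace_sum block_sl column_radical = column_parabolic"
  "subspace_sum block_sl row_radical = row_parabolic"
  by (rule subspace_sum_block_sl; use lie_subalgebra_blocks in
      \<open>auto simp: block_defs block_projection_def field_simps; algebra\<close>)+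

lemma lie_ideal_blocks:
  "lie_ideal block_sl (A\<^sub>2\<lparr>lie_carrier := block_gl\<rparr>)"
  "lie_ideal diag_line (A\<^sub>2\<lparr>lie_carrier := block_gl\<rparr>)"
  "lie_ideal column_part (A\<^sub>2\<lparr>lie_carrier := column_sl\<rparr>)"
  "lie_ideal row_part (A\<^sub>2\<lparr>lie_carrier := row_sl\<rparr>)"
  "lie_ideal column_radical (A\<^sub>2\<lparr>lie_carrier := column_parabolic\<rparr>)"
  "lie_ideal row_radical (A\<^sub>2\<lparr>lie_carrier := row_parabolic\<rparr>)"
proof -
  have idealI: "lie_ideal V (A\<^sub>2\<lparr>lie_carrier := M\<rparr>)"
    if "lie_subalgebra V A\<^sub>2" "\<And>A. A \<in> V \<Longrightarrow> A \<in> M"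
      "\<And>A B. A \<in> M \<Longrightarrow> B \<in> V \<Longrightarrow> A ** B - B ** A \<in> V" for V M
    using that by (auto simp: lie_ideal_def lie_subalgebra_def)
  show "lie_ideal block_sl (A\<^sub>2\<lparr>lie_carrier := block_gl\<rparr>)"
    "lie_ideal diag_line (A\<^sub>2\<lparr>lie_carrier := block_gl\<rparr>)"
    "lie_ideal column_part (A\<^sub>2\<lparr>lie_carrier := column_sl\<rparr>)"
    "lie_ideal row_part (A\<^sub>2\<lparr>lie_carrier := row_sl\<rparr>)"
    "lie_ideal column_radical (A\<^sub>2\<lparr>lie_carrier := column_parabolic\<rparr>)"
    "lie_ideal row_radical (A\<^sub>2\<lparr>lie_carrier := row_parabolic\<rparr>)"
    by (rule idealI[OF lie_subalgebra_blocks(1)] idealI[OF lie_subalgebra_blocks(7)]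
      idealI[OF lie_subalgebra_blocks(8)] idealI[OF lie_subalgebra_blocks(9)]
      idealI[OF lie_subalgebra_blocks(10)] idealI[OF lie_subalgebra_blocks(11)];
      simp add: block_defs matrix_matrix_mult_def sum_3; algebra)+
qed

lemma block_sl_Int:
  "block_sl \<inter> diag_line = {0}" "block_sl \<inter> column_part = {0}" "block_sl \<inter> row_part = {0}"
  "block_sl \<inter> column_radical = {0}" "block_sl \<inter> row_radical = {0}"
  by (auto simp: block_defs vec_eq_iff forall_3)

text \<open>A nonzero solvable ideal would yield a nonzero abelian ideal \<open>W\<close>. For
  \<open>A\<close> in \<open>W\<close>, the double bracket of \<open>A\<close> with any
  \<open>T\<close> is zero; for \<open>x\<^sub>3\<close> and \<open>y\<^sub>3\<close> it contains
  multiples of squares of the entries of \<open>A\<close>, so that \<open>A = 0\<close>.\<close>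

lemma lie_semisimple_block_sl: "lie_semisimple (A\<^sub>2\<lparr>lie_carrier := block_sl\<rparr>)"
  unfolding lie_semisimple_def
proof (intro allI impI, rule ccontr)
  let ?G = "A\<^sub>2\<lparr>lie_carrier := block_sl\<rparr>"
  fix I assume I: "lie_ideal I ?G \<and> lie_solvable (?G\<lparr>lie_carrier := I\<rparr>)" "I \<noteq> {0}"
  have G: "lie_algebra ?G" by (rule lie_algebra_subalgebra[OF lie_algebra_sl lie_subalgebra_blocks(1)])
  obtain W where W: "lie_ideal W ?G" "W \<noteq> {0}"
    and ab: "\<And>A B. A \<in> W \<Longrightarrow> B \<in> W \<Longrightarrow> lie_bracket ?G A B = 0"
    using solvable_ideal_has_abelian_ideal[OF G] I by metis
  have Wsl: "W \<subseteq> block_sl" and Wsub: "mspace.subspace W"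
    and ideal: "\<And>T A. T \<in> block_sl \<Longrightarrow> A \<in> W \<Longrightarrow> T ** A - A ** T \<in> W"
    using W(1) by (auto simp: lie_ideal_def)
  obtain A where A: "A \<in> W" "A \<noteq> 0" using W(2) mspace.subspace_0[OF Wsub] by blast
  have "A ** (T ** A - A ** T) - (T ** A - A ** T) ** A = 0" if "T \<in> block_sl" for T
    using ab[OF A(1) ideal[OF that A(1)]] by simp
  moreover have "h\<^sub>1 + h\<^sub>2 \<in> block_sl" "x\<^sub>3 \<in> block_sl" "y\<^sub>3 \<in> block_sl"
    by (simp_all add: block_sl_def chevalley_defs)
  ultimately have eqs:
    "A ** ((h\<^sub>1 + h\<^sub>2) ** A - A ** (h\<^sub>1 + h\<^sub>2)) - ((h\<^sub>1 + h\<^sub>2) ** A - A ** (h\<^sub>1 + h\<^sub>2)) ** A = 0"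
    "A ** (x\<^sub>3 ** A - A ** x\<^sub>3) - (x\<^sub>3 ** A - A ** x\<^sub>3) ** A = 0"
    "A ** (y\<^sub>3 ** A - A ** y\<^sub>3) - (y\<^sub>3 ** A - A ** y\<^sub>3) ** A = 0"
    by blast+
  have z: "A$1$2 = 0" "A$3$2 = 0" "A$2$1 = 0" "A$2$3 = 0" "A$2$2 = 0" "A$3$3 = - A$1$1"
    using Wsl A(1) by (auto simp: block_sl_def add_eq_0_iff)
  have "A$3$1 = 0" using eqs(2) by (simp add: coords_3 chevalley_defs z)
  moreover have "A$1$3 = 0" using eqs(3) by (simp add: coords_3 chevalley_defs z)
  moreover have "A$1$1 = 0" using eqs(2) calculation by (simp add: coords_3 chevalley_defs z)
  ultimately show False using A(2) z by (simp add: vec_eq_iff forall_3)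
qed

text \<open>Brackets within a radical lose the diagonal and land in the abelian
  \<open>column_part\<close> or \<open>row_part\<close>.\<close>

lemma lie_solvable_radicals:
  "lie_solvable (A\<^sub>2\<lparr>lie_carrier := diag_line\<rparr>)"
  "lie_solvable (A\<^sub>2\<lparr>lie_carrier := column_part\<rparr>)"
  "lie_solvable (A\<^sub>2\<lparr>lie_carrier := row_part\<rparr>)"
  "lie_solvable (A\<^sub>2\<lparr>lie_carrier := column_radical\<rparr>)"
  "lie_solvable (A\<^sub>2\<lparr>lie_carrier := row_radical\<rparr>)"
proof -
  have col: "A ** B - B ** A \<in> column_part" if "A \<in> column_radical" "B \<in> column_radical" for A B
    using that by (simp add: block_defs matrix_matrix_mult_def sum_3)
  have row: "A ** B - B ** A \<in> row_part" if "A \<in> row_radical" "B \<in> row_radical" for A B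
    using that by (simp add: block_defs matrix_matrix_mult_def sum_3)
  have ab: "A ** B - B ** A = 0"
    if "A \<in> column_part \<and> B \<in> column_part \<or> A \<in> row_part \<and> B \<in> row_part" for A B
    using that by (auto simp: block_defs coords_3)
  have sub: "diag_line \<subseteq> column_radical" "column_part \<subseteq> column_radical" "row_part \<subseteq> row_radical"
    by (auto simp: block_defs)
  show "lie_solvable (A\<^sub>2\<lparr>lie_carrier := diag_line\<rparr>)"
    "lie_solvable (A\<^sub>2\<lparr>lie_carrier := column_part\<rparr>)"
    "lie_solvable (A\<^sub>2\<lparr>lie_carrier := row_part\<rparr>)"
    "lie_solvable (A\<^sub>2\<lparr>lie_carrier := column_radical\<rparr>)"
    "lie_solvable (A\<^sub>2\<lparr>lie_carrier := row_radical\<rparr>)"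
    by (rule lie_solvable_two_step[OF lie_algebra_sl];
      use lie_subalgebra_blocks col row ab sub in \<open>simp add: subset_iff\<close>)+
qed

lemma is_semidirect_sum_blocks:
  "is_semidirect_sum (A\<^sub>2\<lparr>lie_carrier := block_gl\<rparr>) block_sl diag_line"
  "is_semidirect_sum (A\<^sub>2\<lparr>lie_carrier := column_sl\<rparr>) block_sl column_part"
  "is_semidirect_sum (A\<^sub>2\<lparr>lie_carrier := row_sl\<rparr>) block_sl row_part"
  "is_semidirect_sum (A\<^sub>2\<lparr>lie_carrier := column_parabolic\<rparr>) block_sl column_radical"
  "is_semidirect_sum (A\<^sub>2\<lparr>lie_carrier := row_parabolic\<rparr>) block_sl row_radical"
proof -
  have "lie_subalgebra block_sl (A\<^sub>2\<lparr>lie_carrier := M\<rparr>)" if "block_sl \<subseteq> M" for M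
    using lie_subalgebra_blocks(1) that by (simp add: lie_subalgebra_def)
  moreover have "block_sl \<subseteq> block_gl" "block_sl \<subseteq> column_sl" "block_sl \<subseteq> row_sl"
    "block_sl \<subseteq> column_parabolic" "block_sl \<subseteq> row_parabolic"
    by (auto simp: block_defs)
  ultimately show "is_semidirect_sum (A\<^sub>2\<lparr>lie_carrier := block_gl\<rparr>) block_sl diag_line"
    "is_semidirect_sum (A\<^sub>2\<lparr>lie_carrier := column_sl\<rparr>) block_sl column_part"
    "is_semidirect_sum (A\<^sub>2\<lparr>lie_carrier := row_sl\<rparr>) block_sl row_part"
    "is_semidirect_sum (A\<^sub>2\<lparr>lie_carrier := column_parabolic\<rparr>) block_sl column_radical"
    "is_semidirect_sum (A\<^sub>2\<lparr>lie_carrier := row_parabolic\<rparr>) block_sl row_radical"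
    by (simp_all add: is_semidirect_sum_def lie_ideal_blocks block_sl_Int subspace_sum_blocks)
qed

lemma is_direct_sum_block_gl:
  "is_direct_sum (A\<^sub>2\<lparr>lie_carrier := block_gl\<rparr>) block_sl diag_line"
  by (simp add: is_direct_sum_def lie_ideal_blocks block_sl_Int subspace_sum_blocks)

lemma levi_decomposable_blocks:
  "levi_decomposable (A\<^sub>2\<lparr>lie_carrier := block_gl\<rparr>)"
  "levi_decomposable (A\<^sub>2\<lparr>lie_carrier := column_sl\<rparr>)"
  "levi_decomposable (A\<^sub>2\<lparr>lie_carrier := row_sl\<rparr>)"
  "levi_decomposable (A\<^sub>2\<lparr>lie_carrier := column_parabolic\<rparr>)"
  "levi_decomposable (A\<^sub>2\<lparr>lie_carrier := row_parabolic\<rparr>)"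
proof -
  have leviI: "levi_decomposable (A\<^sub>2\<lparr>lie_carrier := M\<rparr>)"
    if "is_semidirect_sum (A\<^sub>2\<lparr>lie_carrier := M\<rparr>) block_sl V"
      "lie_solvable (A\<^sub>2\<lparr>lie_carrier := V\<rparr>)" "B \<in> V" "B \<noteq> 0" for M V B
  proof -
    have "x\<^sub>3 \<in> block_sl" "x\<^sub>3 \<noteq> 0" by (simp_all add: block_sl_def chevalley_defs vec_eq_iff forall_3)
    then show ?thesis
      unfolding levi_decomposable_def
      by (intro exI[of _ block_sl] exI[of _ V]) (use that lie_semisimple_block_sl in auto)
  qed
  have "h\<^sub>1 - h\<^sub>2 \<noteq> 0" "x\<^sub>1 \<noteq> 0" "x\<^sub>2 \<noteq> 0"
    by (simp_all add: chevalley_defs vec_eq_iff forall_3)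
  moreover have "h\<^sub>1 - h\<^sub>2 \<in> diag_line" "x\<^sub>1 \<in> column_part" "x\<^sub>2 \<in> row_part"
    "h\<^sub>1 - h\<^sub>2 \<in> column_radical" "h\<^sub>1 - h\<^sub>2 \<in> row_radical"
    by (simp_all add: block_defs chevalley_defs)
  ultimately show "levi_decomposable (A\<^sub>2\<lparr>lie_carrier := block_gl\<rparr>)"
    "levi_decomposable (A\<^sub>2\<lparr>lie_carrier := column_sl\<rparr>)"
    "levi_decomposable (A\<^sub>2\<lparr>lie_carrier := row_sl\<rparr>)"
    "levi_decomposable (A\<^sub>2\<lparr>lie_carrier := column_parabolic\<rparr>)"
    "levi_decomposable (A\<^sub>2\<lparr>lie_carrier := row_parabolic\<rparr>)"
    using leviI is_semidirect_sum_blocks lie_solvable_radicals by metis+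
qed

section \<open>Isomorphism types\<close>

text \<open>From here on the choice of the Chevalley basis enters only through this image.\<close>

lemma chi_image:
  assumes "A1_chevalley_basis x y h" and "is_chi x y h ch"
  shows "ch ` lie_carrier A\<^sub>1 = block_sl"
proof
  have span: "mspace.span {x, y, h} = lie_carrier A\<^sub>1" using assms(1) by (simp add: A1_chevalley_basis_def)
  have ch: "lie_hom ch A\<^sub>1 A\<^sub>2" and vals: "ch x = x\<^sub>3" "ch y = y\<^sub>3" "ch h = h\<^sub>1 + h\<^sub>2"
    using assms(2) by (auto simp: is_chi_def)
  note chD = lie_homD[OF ch, simplified] and sub = sl3_subalgebraD[OF lie_subalgebra_blocks(1)]
  have xyh: "{x, y, h} \<subseteq> lie_carrier A\<^sub>1" unfolding span[symmetric] by (rule mspace.span_superset)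
  have "lie_subalgebra (ch ` lie_carrier A\<^sub>1) A\<^sub>2"
    using lie_algebraD(2,3)[OF lie_algebra_sl]
    by (intro lie_subalgebra_image[OF lie_algebra_sl lie_algebra_sl ch]) (auto simp: lie_subalgebra_def)
  moreover have "{x\<^sub>3, y\<^sub>3, h\<^sub>1 + h\<^sub>2} \<subseteq> ch ` lie_carrier A\<^sub>1"
    unfolding vals[symmetric] using xyh by blast
  ultimately show "block_sl \<subseteq> ch ` lie_carrier A\<^sub>1"
    unfolding lie_generated_blocks(1)[symmetric] lie_generated_def by (intro hull_minimal)
  have "lie_carrier A\<^sub>1 \<subseteq> {T. trace T = 0 \<and> ch T \<in> block_sl}"
    unfolding span[symmetric]
  proof (rule mspace.span_minimal)
    have "x\<^sub>3 \<in> block_sl" "y\<^sub>3 \<in> block_sl" "h\<^sub>1 + h\<^sub>2 \<in> block_sl"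
      by (simp_all add: block_sl_def chevalley_defs)
    then show "{x, y, h} \<subseteq> {T. trace T = 0 \<and> ch T \<in> block_sl}" using xyh by (simp add: vals)
    have tr: "mspace.subspace {T :: complex^2^2. trace T = 0}"
      using lie_algebraD(2)[OF lie_algebra_sl[where 'n = 2]] by simp
    show "mspace.subspace {T. trace T = 0 \<and> ch T \<in> block_sl}"
      using mspace.subspace_0[OF tr] mspace.subspace_add[OF tr] mspace.subspace_scale[OF tr]
        lie_hom_0[OF lie_algebra_sl ch] sub
      by (intro mspace.subspaceI) (auto simp: chD)
  qed
  then show "ch ` lie_carrier A\<^sub>1 \<subseteq> block_sl" by blast
qed

text \<open>\<open>inv \<psi>\<close> is controlled on the range of \<psi> only, which is where
  \<open>stable\<close> puts the brackets. Both sides are linear in \<open>z\<close>, so the basis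
  vectors decide.\<close>

lemma induced_action_eq:
  fixes K :: "(complex^'n) lie"
  assumes K: "lie_carrier K = UNIV" "lie_scale K = (*s)"
    and psi: "lie_hom \<psi> K A\<^sub>2"
    and stable: "\<And>z. ch T ** \<psi> z - \<psi> z ** ch T \<in> range \<psi>"
  shows "\<psi> (induced_action ch \<psi> T z) = ch T ** \<psi> z - \<psi> z ** ch T"
proof -
  have add: "\<psi> (u + v) = \<psi> u + \<psi> v" and scale: "\<psi> (c *s u) = mscale c (\<psi> u)" for u v c
    using lie_homD(2,3)[OF psi] by (simp_all add: K)
  have zero: "\<psi> 0 = 0" using scale[of 0 0] by simp
  have sum: "\<psi> (\<Sum>i\<in>S. f i) = (\<Sum>i\<in>S. \<psi> (f i))" for f and S :: "'n set"
    by (induction S rule: infinite_finite_induct) (simp_all add: zero add)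
  define B where "B A = ch T ** A - A ** ch T" for A
  have Badd: "B (A + A') = B A + B A'" and Bscale: "B (mscale k A) = mscale k (B A)" for A A' k
    by (simp_all add: B_def coords_3 algebra_simps)
  have Bsum: "B (\<Sum>i\<in>S. f i) = (\<Sum>i\<in>S. B (f i))" for f and S :: "'n set"
  proof (induction S rule: infinite_finite_induct)
    case (infinite S)
    then show ?case using Bscale[of 0 0] by simp
  next
    case empty
    then show ?case using Bscale[of 0 0] by simp
  qed (simp add: Badd)
  have "\<psi> (induced_action ch \<psi> T z) = (\<Sum>i\<in>UNIV. mscale (z$i) (B (\<psi> (axis i 1))))"
    using stable by (simp add: induced_action_def sum scale f_inv_into_f B_def)
  also have "\<dots> = B (\<psi> (\<Sum>i\<in>UNIV. z$i *s axis i 1))"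
    by (simp add: sum scale Bsum Bscale)
  finally show ?thesis by (simp add: basis_expansion B_def)
qed

lemma lie_hom_image_restrict:
  assumes "lie_hom f H (G\<lparr>lie_carrier := M\<rparr>)" "lie_hom g G G" "M \<subseteq> lie_carrier G"
  shows "lie_hom (g \<circ> f) H (G\<lparr>lie_carrier := g ` M\<rparr>)"
  using assms by (auto simp: lie_hom_def subset_iff image_subset_iff)

text \<open>The detour through \<open>g\<close> lets an isomorphism for a \<open>column\<close>
  algebra serve for its \<open>row\<close> counterpart.\<close>

lemma lie_isomorphic_image:
  assumes f: "lie_hom f H (G\<lparr>lie_carrier := M\<rparr>)" "bij_betw f (lie_carrier H) M"
    and g: "lie_hom g G G" "inj_on g M" and M: "M \<subseteq> lie_carrier G"
    and "\<And>a b. a \<in> lie_carrier H \<Longrightarrow> b \<in> lie_carrier H \<Longrightarrow> a + b \<in> lie_carrier H"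
    and "\<And>k a. a \<in> lie_carrier H \<Longrightarrow> lie_scale H k a \<in> lie_carrier H"
    and "\<And>a b. a \<in> lie_carrier H \<Longrightarrow> b \<in> lie_carrier H \<Longrightarrow>
      lie_bracket H a b \<in> lie_carrier H"
  shows "lie_isomorphic (G\<lparr>lie_carrier := g ` M\<rparr>) H"
proof (rule lie_isomorphic_via_inverse[OF lie_hom_image_restrict[OF f(1) g(1) M]])
  show "bij_betw (g \<circ> f) (lie_carrier H) (lie_carrier (G\<lparr>lie_carrier := g ` M\<rparr>))"
    using f(2) inj_on_imp_bij_betw[OF g(2)] by (simp add: bij_betw_trans)
qed (use assms in auto)

lemma bij_betw_subspace_sum:
  fixes f :: "'a \<Rightarrow> complex^3^3" and g :: "'b \<Rightarrow> complex^3^3"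
  assumes f: "inj_on f X" "f ` X = U" and g: "inj g" "range g = V" and int: "U \<inter> V = {0}"
    and U: "lie_subalgebra U A\<^sub>2" and V: "lie_subalgebra V A\<^sub>2"
  shows "bij_betw (\<lambda>(a, b). f a + g b) (X \<times> UNIV) (subspace_sum U V)"
proof (rule bij_betw_imageI)
  have "a = a' \<and> b = b'" if "a \<in> X" "a' \<in> X" "f a + g b = f a' + g b'" for a a' b b'
  proof -
    have "f a \<in> U" "f a' \<in> U" "g b \<in> V" "g b' \<in> V" using that f g by auto
    then have "f a - f a' \<in> U" "g b' - g b \<in> V"
      using U V by (auto simp: lie_subalgebra_def mspace.subspace_diff)
    moreover have eq: "f a - f a' = g b' - g b" using that(3) by (simp add: algebra_simps)
    ultimately have "f a - f a' \<in> U \<inter> V" by simp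
    then have "f a = f a'" "g b = g b'" using eq unfolding int by simp_all
    then show ?thesis using inj_onD[OF f(1) _ that(1,2)] injD[OF g(1)] by blast
  qed
  then show "inj_on (\<lambda>(a, b). f a + g b) (X \<times> UNIV)" by (auto intro!: inj_onI)
  show "(\<lambda>(a, b). f a + g b) ` (X \<times> UNIV) = subspace_sum U V"
    unfolding subspace_sum_def f(2)[symmetric] g(2)[symmetric] by auto
qed

lemma sl_closed:
  fixes A B :: "complex^'n^'n"
  assumes "trace A = 0" "trace B = 0"
  shows "trace (A + B) = 0" "trace (mscale k A) = 0" "trace (A ** B - B ** A) = 0"
proof -
  note G = lie_algebra_sl[where 'n = 'n]
  show "trace (mscale k A) = 0" "trace (A + B) = 0"
    using mspace.subspace_scale[of "{A :: complex^'n^'n. trace A = 0}"]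
      mspace.subspace_add[of "{A :: complex^'n^'n. trace A = 0}"] lie_algebraD(2)[OF G] assms by auto
  show "trace (A ** B - B ** A) = 0" using lie_algebraD(3)[OF G, of A B] assms by simp
qed

text \<open>The automorphism \<open>\<theta>\<close> is either the identity or \<open>neg_transpose\<close>.\<close>

lemma lie_isomorphic_semidirect:
  fixes K :: "(complex^'n) lie"
  assumes ch: "lie_hom ch A\<^sub>1 A\<^sub>2" "inj_on ch (lie_carrier A\<^sub>1)" "ch ` lie_carrier A\<^sub>1 = block_sl"
    and K: "lie_carrier K = UNIV" "lie_scale K = (*s)"
    and psi: "lie_hom \<psi> K A\<^sub>2" "inj \<psi>" "range \<psi> = V"
    and semi: "is_semidirect_sum (A\<^sub>2\<lparr>lie_carrier := M\<rparr>) block_sl V"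
    and M: "lie_subalgebra M A\<^sub>2" and th: "lie_hom \<theta> A\<^sub>2 A\<^sub>2" "inj \<theta>"
  shows "lie_isomorphic (A\<^sub>2\<lparr>lie_carrier := \<theta> ` M\<rparr>) (lie_semidirect_sum A\<^sub>1 (induced_action ch \<psi>) K)"
proof (rule lie_isomorphic_image[where f = "\<lambda>(T, z). ch T + \<psi> z"])
  let ?F = "\<lambda>(T, z). ch T + \<psi> z"
  let ?H = "lie_semidirect_sum A\<^sub>1 (induced_action ch \<psi>) K"
  have V: "lie_ideal V (A\<^sub>2\<lparr>lie_carrier := M\<rparr>)" "block_sl \<inter> V = {0}" "M = subspace_sum block_sl V"
    and "block_sl \<subseteq> M"
    using semi by (auto simp: is_semidirect_sum_def lie_subalgebra_def)
  have VM: "V \<subseteq> M" using V(1) by (simp add: lie_ideal_def)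
  have Vsub: "lie_subalgebra V A\<^sub>2"
    using lie_ideal_imp_subalgebra[OF V(1)] M by (auto simp: lie_subalgebra_def)
  have chM: "ch T \<in> M" if "trace T = 0" for T using ch(3) \<open>block_sl \<subseteq> M\<close> that by auto
  note chD = lie_homD[OF ch(1), simplified] and psiD = lie_homD[OF psi(1), simplified K, simplified]
    and MD = sl3_subalgebraD[OF M]
  have act: "\<psi> (induced_action ch \<psi> T z) = ch T ** \<psi> z - \<psi> z ** ch T" if "trace T = 0" for T z
    using V(1) psi(3) chM[OF that] by (intro induced_action_eq[OF K psi(1)]) (auto simp: lie_ideal_def)
  have psi_diff: "\<psi> (u - v) = \<psi> u - \<psi> v" for u v
    using psiD(2)[of "u - v" v] by (simp add: algebra_simps)
  \<comment> \<open>For \<open>A\<close>, \<open>B\<close> in the block and \<open>C\<close>,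
    \<open>D\<close> in the ideal, this splits the bracket into the two components of the external
    semidirect sum.\<close>
  have expand: "(A + C) ** (B + D) - (B + D) ** (A + C) =
      (A ** B - B ** A) + ((A ** D - D ** A) - (B ** C - C ** B) + (C ** D - D ** C))"
    for A B C D :: "complex^3^3"
    by (simp add: coords_3 algebra_simps)
  show "lie_hom ?F ?H (A\<^sub>2\<lparr>lie_carrier := M\<rparr>)"
    using chM VM psi(3) MD(3)
    by (auto simp: lie_hom_def lie_semidirect_sum_def K chD psiD psi_diff act sl_closed
        mspace.scale_right_distrib expand)
  show "bij_betw ?F (lie_carrier ?H) M"
    unfolding V(3) lie_semidirect_sum_def using ch(2,3) psi(2,3) V(2) lie_subalgebra_blocks(1) Vsub
    by (simp add: K bij_betw_subspace_sum)
  show "lie_hom \<theta> A\<^sub>2 A\<^sub>2" "inj_on \<theta> M" "M \<subseteq> lie_carrier A\<^sub>2"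
    using th MD(1) by (auto intro: inj_on_subset)
qed (auto simp: lie_semidirect_sum_def K sl_closed)

lemma lie_isomorphic_block_gl:
  assumes ch: "lie_hom ch A\<^sub>1 A\<^sub>2" "inj_on ch (lie_carrier A\<^sub>1)" "ch ` lie_carrier A\<^sub>1 = block_sl"
  shows "lie_isomorphic (A\<^sub>2\<lparr>lie_carrier := block_gl\<rparr>) (lie_direct_sum A\<^sub>1 J)"
proof (rule lie_isomorphic_via_inverse[where f = "\<lambda>(T, c). ch T + mscale c (h\<^sub>1 - h\<^sub>2)"])
  let ?F = "\<lambda>(T, c). ch T + mscale c (h\<^sub>1 - h\<^sub>2)"
  let ?H = "lie_direct_sum A\<^sub>1 J"
  note chD = lie_homD[OF ch(1), simplified]
  have chb: "ch T \<in> block_sl" if "trace T = 0" for T using ch(3) that by auto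
  have mem: "A + mscale c (h\<^sub>1 - h\<^sub>2) \<in> block_gl" if "A \<in> block_sl" for A c
    using that by (simp add: block_defs chevalley_defs mscale_def algebra_simps)
  \<comment> \<open>\<open>h\<^sub>1 - h\<^sub>2\<close> is scalar on the block, hence commutes with
    \<open>block_sl\<close>.\<close>
  have bracket: "(A + mscale c (h\<^sub>1 - h\<^sub>2)) ** (B + mscale d (h\<^sub>1 - h\<^sub>2)) -
      (B + mscale d (h\<^sub>1 - h\<^sub>2)) ** (A + mscale c (h\<^sub>1 - h\<^sub>2)) = A ** B - B ** A"
    if "A \<in> block_sl" "B \<in> block_sl" for A B c d
    using that by (simp add: coords_3 chevalley_defs block_defs algebra_simps)
  show "lie_hom ?F ?H (A\<^sub>2\<lparr>lie_carrier := block_gl\<rparr>)"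
    by (auto simp: lie_hom_def lie_direct_sum_def J_def chD mem chb bracket
        mspace.scale_right_distrib mspace.scale_left_distrib)
  have "inj (\<lambda>c. mscale c (h\<^sub>1 - h\<^sub>2))"
    by (rule injI) (simp add: vec_eq_iff forall_3 mscale_def chevalley_defs)
  moreover have "range (\<lambda>c. mscale c (h\<^sub>1 - h\<^sub>2)) = diag_line"
  proof (intro set_eqI iffI)
    fix A assume "A \<in> diag_line"
    then have "A = mscale (A$1$1) (h\<^sub>1 - h\<^sub>2)"
      by (simp add: vec_eq_iff forall_3 mscale_def chevalley_defs block_defs)
    then show "A \<in> range (\<lambda>c. mscale c (h\<^sub>1 - h\<^sub>2))" by blast
  qed (auto simp: mscale_def chevalley_defs block_defs)
  ultimately show "bij_betw ?F (lie_carrier ?H) (lie_carrier (A\<^sub>2\<lparr>lie_carrier := block_gl\<rparr>))"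
    using bij_betw_subspace_sum[OF ch(2,3)] block_sl_Int(1) lie_subalgebra_blocks(1,7)
    by (simp add: lie_direct_sum_def J_def flip: subspace_sum_blocks(1))
qed (auto simp: lie_direct_sum_def J_def sl_closed)

lemma psi1:
  "lie_hom \<psi>\<^sub>1 K\<^sub>1 A\<^sub>2" "inj \<psi>\<^sub>1" "range \<psi>\<^sub>1 = column_part"
proof -
  show "lie_hom \<psi>\<^sub>1 K\<^sub>1 A\<^sub>2"
    by (simp add: lie_hom_def image_subset_iff \<psi>\<^sub>1_def K\<^sub>1_def coords_3 chevalley_defs algebra_simps)
  show "inj \<psi>\<^sub>1"
    by (rule injI) (simp add: \<psi>\<^sub>1_def vec_eq_iff forall_2 forall_3 mscale_def chevalley_defs)
  show "range \<psi>\<^sub>1 = column_part"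
  proof (intro set_eqI iffI)
    fix A assume "A \<in> column_part"
    then have "A = \<psi>\<^sub>1 (vector [A$1$2, A$3$2])"
      by (simp add: \<psi>\<^sub>1_def vec_eq_iff forall_3 mscale_def chevalley_defs block_defs)
    then show "A \<in> range \<psi>\<^sub>1" by blast
  qed (auto simp: \<psi>\<^sub>1_def mscale_def chevalley_defs block_defs)
qed

lemma psi2:
  "lie_hom \<psi>\<^sub>2 L\<^sub>2 A\<^sub>2" "inj \<psi>\<^sub>2" "range \<psi>\<^sub>2 = column_radical"
proof -
  show "lie_hom \<psi>\<^sub>2 L\<^sub>2 A\<^sub>2"
    by (simp add: lie_hom_def image_subset_iff \<psi>\<^sub>2_def L\<^sub>2_def coords_3 chevalley_defs algebra_simps
        diff_divide_distrib)
  show "inj \<psi>\<^sub>2"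
    by (rule injI) (simp add: \<psi>\<^sub>2_def vec_eq_iff forall_3 mscale_def chevalley_defs)
  show "range \<psi>\<^sub>2 = column_radical"
  proof (intro set_eqI iffI)
    fix A assume "A \<in> column_radical"
    \<comment> \<open>The 3 undoes the factor 1/3 in the image of the third basis vector, which
      normalises its action on \<open>x\<^sub>1\<close> and \<open>y\<^sub>2\<close> to the
      identity.\<close>
    then have "A = \<psi>\<^sub>2 (vector [A$1$2, A$3$2, 3 * A$1$1])"
      by (simp add: \<psi>\<^sub>2_def vec_eq_iff forall_3 mscale_def chevalley_defs block_defs)
    then show "A \<in> range \<psi>\<^sub>2" by blast
  qed (auto simp: \<psi>\<^sub>2_def mscale_def chevalley_defs block_defs)
qed

lemma lie_isomorphic_blocks:
  assumes "A1_chevalley_basis x y h" and "is_chi x y h ch"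
  shows "lie_isomorphic (A\<^sub>2\<lparr>lie_carrier := column_sl\<rparr>) (lie_semidirect_sum A\<^sub>1 (\<phi>\<^sub>1 ch) K\<^sub>1)"
    and "lie_isomorphic (A\<^sub>2\<lparr>lie_carrier := row_sl\<rparr>) (lie_semidirect_sum A\<^sub>1 (\<phi>\<^sub>1 ch) K\<^sub>1)"
    and "lie_isomorphic (A\<^sub>2\<lparr>lie_carrier := column_parabolic\<rparr>) (lie_semidirect_sum A\<^sub>1 (\<phi>\<^sub>2 ch) L\<^sub>2)"
    and "lie_isomorphic (A\<^sub>2\<lparr>lie_carrier := row_parabolic\<rparr>) (lie_semidirect_sum A\<^sub>1 (\<phi>\<^sub>2 ch) L\<^sub>2)"
proof -
  have ch: "lie_hom ch A\<^sub>1 A\<^sub>2" "inj_on ch (lie_carrier A\<^sub>1)" "ch ` lie_carrier A\<^sub>1 = block_sl"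
    using assms(2) chi_image[OF assms] by (auto simp: is_chi_def)
  have id: "lie_hom (\<lambda>A. A) A\<^sub>2 A\<^sub>2" by (simp add: lie_hom_def)
  have K: "lie_carrier K\<^sub>1 = UNIV" "lie_scale K\<^sub>1 = (*s)" by (simp_all add: K\<^sub>1_def)
  note iso1 = lie_isomorphic_semidirect[OF ch K psi1 is_semidirect_sum_blocks(2)
      lie_subalgebra_blocks(3), folded \<phi>\<^sub>1_def]
  have L: "lie_carrier L\<^sub>2 = UNIV" "lie_scale L\<^sub>2 = (*s)" by (simp_all add: L\<^sub>2_def)
  note iso2 = lie_isomorphic_semidirect[OF ch L psi2 is_semidirect_sum_blocks(4)
      lie_subalgebra_blocks(5), folded \<phi>\<^sub>2_def]
  show "lie_isomorphic (A\<^sub>2\<lparr>lie_carrier := column_sl\<rparr>) (lie_semidirect_sum A\<^sub>1 (\<phi>\<^sub>1 ch) K\<^sub>1)"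
    "lie_isomorphic (A\<^sub>2\<lparr>lie_carrier := column_parabolic\<rparr>) (lie_semidirect_sum A\<^sub>1 (\<phi>\<^sub>2 ch) L\<^sub>2)"
    using iso1[OF id] iso2[OF id] by simp_all
  show "lie_isomorphic (A\<^sub>2\<lparr>lie_carrier := row_sl\<rparr>) (lie_semidirect_sum A\<^sub>1 (\<phi>\<^sub>1 ch) K\<^sub>1)"
    "lie_isomorphic (A\<^sub>2\<lparr>lie_carrier := row_parabolic\<rparr>) (lie_semidirect_sum A\<^sub>1 (\<phi>\<^sub>2 ch) L\<^sub>2)"
    \<comment> \<open>The \<open>row\<close> algebras are the negative transposes of the
      \<open>column\<close> algebras, hence the same actions \<open>\<phi>\<^sub>1\<close> and
      \<open>\<phi>\<^sub>2\<close>.\<close>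
    using iso1[OF lie_hom_neg_transpose] iso2[OF lie_hom_neg_transpose]
    by (simp_all add: neg_transpose_images)
qed

theorem theorem5p2:
  fixes x y h :: "complex^2^2" and ch :: "complex^2^2 \<Rightarrow> complex^3^3"
  assumes "A1_chevalley_basis x y h" and "is_chi x y h ch"
  shows
    "let g = lie_generated A\<^sub>2 {x\<^sub>3, y\<^sub>3, h\<^sub>1 + h\<^sub>2};
         s = (!) [lie_generated A\<^sub>2 {h\<^sub>1 - h\<^sub>2},
                  lie_generated A\<^sub>2 {x\<^sub>1, y\<^sub>2},
                  lie_generated A\<^sub>2 {x\<^sub>2, y\<^sub>1},
                  lie_generated A\<^sub>2 {h\<^sub>1 - h\<^sub>2, x\<^sub>1, y\<^sub>2},
                  lie_generated A\<^sub>2 {h\<^sub>1 - h\<^sub>2, x\<^sub>2, y\<^sub>1}];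
         M = (\<lambda>i. subspace_sum g (s i));
         M_alg = (\<lambda>i. A\<^sub>2\<lparr>lie_carrier := M i\<rparr>)
     in (\<forall>i<5. lie_subalgebra (M i) A\<^sub>2 \<and> levi_decomposable (M_alg i)) \<and>
        (\<forall>N. lie_subalgebra N A\<^sub>2 \<and> levi_decomposable (A\<^sub>2\<lparr>lie_carrier := N\<rparr>) \<longrightarrow>
             (\<exists>!i. i < 5 \<and> inner_equivalent N (M i))) \<and>
        (\<forall>i<5. \<forall>j<5. i \<noteq> j \<longrightarrow> \<not> inner_equivalent (M i) (M j)) \<and>
        is_direct_sum (M_alg 0) g (s 0) \<and>
        (\<forall>i\<in>{1, 2, 3, 4}. is_semidirect_sum (M_alg i) g (s i)) \<and>
        lie_isomorphic (M_alg 0) (lie_direct_sum A\<^sub>1 J) \<and>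
        lie_isomorphic (M_alg 1) (lie_semidirect_sum A\<^sub>1 (\<phi>\<^sub>1 ch) K\<^sub>1) \<and>
        lie_isomorphic (M_alg 2) (lie_semidirect_sum A\<^sub>1 (\<phi>\<^sub>1 ch) K\<^sub>1) \<and>
        lie_isomorphic (M_alg 3) (lie_semidirect_sum A\<^sub>1 (\<phi>\<^sub>2 ch) L\<^sub>2) \<and>
        lie_isomorphic (M_alg 4) (lie_semidirect_sum A\<^sub>1 (\<phi>\<^sub>2 ch) L\<^sub>2)"
proof -
  define s where "s = (!) [diag_line, column_part, row_part, column_radical, row_radical]"
  define M where "M i = subspace_sum block_sl (s i)" for i
  have s: "s 0 = diag_line" "s 1 = column_part" "s 2 = row_part" "s 3 = column_radical" "s 4 = row_radical"
    by (simp_all add: s_def)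
  have M: "M 0 = block_gl" "M 1 = column_sl" "M 2 = row_sl" "M 3 = column_parabolic" "M 4 = row_parabolic"
    by (simp_all only: M_def s subspace_sum_blocks)
  have less_5: "i < 5 \<longleftrightarrow> i \<in> {0, 1, 2, 3, 4}" for i :: nat by auto
  have levi: "\<forall>i<5. lie_subalgebra (M i) A\<^sub>2 \<and> levi_decomposable (A\<^sub>2\<lparr>lie_carrier := M i\<rparr>)"
    unfolding less_5 using lie_subalgebra_blocks levi_decomposable_blocks by (auto simp: M simp del: One_nat_def)
  have inequivalent: "i = j" if "i < 5" "j < 5" "inner_equivalent (M i) (M j)" for i j
    using that(1,2) inner_equivalent_imp_same_invariants[OF that(3)] unfolding less_5
    by (auto simp: M invariants_column invariants_row invariants_singular simp del: One_nat_def)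
  have "\<exists>!i. i < 5 \<and> inner_equivalent N (M i)"
    if "lie_subalgebra N A\<^sub>2" "levi_decomposable (A\<^sub>2\<lparr>lie_carrier := N\<rparr>)" for N
  proof -
    have "\<exists>X\<in>M ` {0, 1, 2, 3, 4}. inner_equivalent N X"
      using levi_decomposable_classification[OF that] unfolding image_insert image_empty M .
    then have "\<exists>i<5. inner_equivalent N (M i)" unfolding less_5 by blast
    \<comment> \<open>If \<open>N\<close> were equivalent to two members of the list, these would be
      equivalent to each other.\<close>
    then show ?thesis
      using inequivalent inner_equivalent_trans[OF inner_equivalent_sym] by blast
  qed
  moreover have "\<forall>i\<in>{1, 2, 3, 4}. is_semidirect_sum (A\<^sub>2\<lparr>lie_carrier := M i\<rparr>) block_sl (s i)"
    using is_semidirect_sum_blocks by (auto simp: M s simp del: One_nat_def)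
  moreover have "is_direct_sum (A\<^sub>2\<lparr>lie_carrier := M 0\<rparr>) block_sl (s 0)"
    by (simp add: M s is_direct_sum_block_gl)
  moreover have "lie_isomorphic (A\<^sub>2\<lparr>lie_carrier := M 0\<rparr>) (lie_direct_sum A\<^sub>1 J)"
    using lie_isomorphic_block_gl[of ch] assms(2) chi_image[OF assms] by (simp add: M is_chi_def)
  ultimately show ?thesis
    using levi inequivalent lie_isomorphic_blocks[OF assms, folded M]
    unfolding Let_def lie_generated_blocks s_def[symmetric] M_def[symmetric] by blast
qed

end
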